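(* Let $X$ be a quasi-abelian variety of kind 0 which is isogenous to a product $X_1 \times \cdots \times X_k$, where each $X_i$ is a geometrically simple quasi-abelian variety of kind 0. Assume that $X$ is isogenous to another product $Y_1 \times \cdots \times Y_{\ell}$ of geometrically simple quasi-abelian varieties $Y_1, \dots, Y_{\ell}$. Then $k = \ell$ and, after a suitable change of indices, $X_i$ is isogenous to $Y_i$ for $i = 1, \dots, k$.
   Context: A toroidal group is a connected complex Lie group without non-constant holomorphic functions; it is of the form $\mathbb{C}^n/\Gamma$ with $\Gamma$ a discrete subgroup of $\mathbb{C}^n$ of rank $n+m$, $1\le m\le n$. Let $\mathbb{R}_\Gamma^{n+m}$ be the real span of $\Gamma$ and $\mathbb{C}_\Gamma^m=\mathbb{R}_\Gamma^{n+m}\cap\sqrt{-1}\,\mathbb{R}_\Gamma^{n+m}$ its maximal complex subspace, of complex dimension $m$. A toroidal group $\mathbb{C}^n/\Gamma$ is a quasi-abelian variety if there is a hermitian form $\mathcal{H}$ on $\mathbb{C}^n$ (an ample Riemann form) which is positive definite on $\mathbb{C}_\Gamma^m$ and whose imaginary part $\mathcal{A}$ is $\mathbb{Z}$-valued on $\Gamma\times\Gamma$. The restriction of $\mathcal{A}$ to $\mathbb{R}_\Gamma^{n+m}\times\mathbb{R}_\Gamma^{n+m}$ has rank $2(m+k)$ with $0\le 2k\le n-m$; $k$ is the kind of $\mathcal{H}$, and the kind of the quasi-abelian variety is the smallest kind of its ample Riemann forms. A toroidal group is geometrically simple if it does not contain a closed toroidal subgroup apart from itself and zero. A homomorphism (holomorphic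 group homomorphism) between connected commutative complex Lie groups is an isogeny if it is surjective with finite kernel; two groups are isogenous if there is an isogeny from one to the other. *)

theory Defs
  imports
    "HOL-Analysis.Analysis"
    "HOL-Analysis.Finite_Function_Topology"
    "HOL-Algebra.Coset"
begin

section \<open>Complex number spaces of varying dimension\<close>

text \<open>
  All spaces \<open>\<complex>\<^sup>n\<close> live inside one real normed vector space: the finitely supported complex
  sequences. On each \<open>Cn n\<close> its norm (the \<open>l\<^sub>1\<close> norm) induces the usual topology. The
  operations \<^const>\<open>span\<close> and \<^const>\<open>dim\<close> on this type are those of real vector spaces.
\<close>

type_synonym cvec = "nat \<Rightarrow>\<^sub>0 complex"

definition Cn :: "nat \<Rightarrow> cvec set" where
  "Cn n = {v. Poly_Mapping.keys v \<subseteq> {..<n}}"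

definition cscale :: "complex \<Rightarrow> cvec \<Rightarrow> cvec" where
  "cscale c v = Poly_Mapping.map ((*) c) v"

lemma lookup_cscale: "Poly_Mapping.lookup (cscale c v) i = c * Poly_Mapping.lookup v i"
  by (simp add: cscale_def Poly_Mapping.map.rep_eq when_def)

definition Cn_group :: "nat \<Rightarrow> cvec monoid" where
  "Cn_group n = \<lparr>carrier = Cn n, monoid.mult = (+), one = 0\<rparr>"

lemma comm_group_Cn: "comm_group (Cn_group n)"
proof (rule comm_groupI)
  fix x y assume "x \<in> carrier (Cn_group n)" "y \<in> carrier (Cn_group n)"
  then show "x \<otimes>\<^bsub>Cn_group n\<^esub> y \<in> carrier (Cn_group n)"
    using Poly_Mapping.keys_add[of x y] by (auto simp: Cn_group_def Cn_def)
next
  fix x assume "x \<in> carrier (Cn_group n)"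
  then show "\<exists>y\<in>carrier (Cn_group n). y \<otimes>\<^bsub>Cn_group n\<^esub> x = \<one>\<^bsub>Cn_group n\<^esub>"
    by (intro bexI[of _ "- x"]) (auto simp: Cn_group_def Cn_def)
qed (auto simp: Cn_group_def Cn_def add_ac)

text \<open>
  Complex (Frechet) differentiability at every point of \<open>U\<close>, for \<open>U\<close> open in \<open>\<complex>\<^sup>n\<close>. The
  derivative is only determined on \<open>\<complex>\<^sup>n\<close>, and is required to be complex linear there.
\<close>

definition holomorphic_Cn :: "nat \<Rightarrow> (cvec \<Rightarrow> complex) \<Rightarrow> cvec set \<Rightarrow> bool" where
  "holomorphic_Cn n f U \<longleftrightarrow>
     (\<forall>z\<in>U. \<exists>f'. (f has_derivative f') (at z within Cn n) \<and>
        (\<forall>c. \<forall>v\<in>Cn n. f' (cscale c v) = c * f' v))"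

definition holomorphic_map_Cn :: "nat \<Rightarrow> nat \<Rightarrow> (cvec \<Rightarrow> cvec) \<Rightarrow> cvec set \<Rightarrow> bool" where
  "holomorphic_map_Cn n p F U \<longleftrightarrow>
     F ` U \<subseteq> Cn p \<and> (\<forall>j<p. holomorphic_Cn n (\<lambda>z. Poly_Mapping.lookup (F z) j) U)"


section \<open>Quotients of complex number spaces by discrete subgroups\<close>

text \<open>The record with fields \<open>n\<close>, \<open>\<Gamma>\<close> stands for the complex Lie group \<open>\<complex>\<^sup>n / \<Gamma>\<close>.\<close>

record cquot =
  cdim :: nat
  periods :: "cvec set"

definition cquot_group :: "cquot \<Rightarrow> cvec set monoid" where
  "cquot_group X = Cn_group (cdim X) Mod periods X"

definition cquot_proj :: "cquot \<Rightarrow> cvec \<Rightarrow> cvec set" where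
  "cquot_proj X z = periods X #>\<^bsub>Cn_group (cdim X)\<^esub> z"

definition is_cquot :: "cquot \<Rightarrow> bool" where
  "is_cquot X \<longleftrightarrow> subgroup (periods X) (Cn_group (cdim X)) \<and> discrete (periods X)"

definition holomorphic_fun :: "cquot \<Rightarrow> (cvec set \<Rightarrow> complex) \<Rightarrow> bool" where
  "holomorphic_fun X f \<longleftrightarrow> holomorphic_Cn (cdim X) (\<lambda>z. f (cquot_proj X z)) (Cn (cdim X))"

text \<open>
  The charts of \<open>\<complex>\<^sup>n / \<Gamma>\<close> are the local inverses of the projection, so a map between two such
  quotients is holomorphic iff it is locally induced by holomorphic maps between the number spaces.
\<close>

definition holomorphic_map :: "cquot \<Rightarrow> cquot \<Rightarrow> (cvec set \<Rightarrow> cvec set) \<Rightarrow> bool" where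
  "holomorphic_map X Y \<phi> \<longleftrightarrow>
     (\<forall>z\<in>Cn (cdim X). \<exists>U F. openin (top_of_set (Cn (cdim X))) U \<and> z \<in> U \<and>
        holomorphic_map_Cn (cdim X) (cdim Y) F U \<and>
        (\<forall>w\<in>U. \<phi> (cquot_proj X w) = cquot_proj Y (F w)))"

definition holomorphic_hom :: "cquot \<Rightarrow> cquot \<Rightarrow> (cvec set \<Rightarrow> cvec set) \<Rightarrow> bool" where
  "holomorphic_hom X Y \<phi> \<longleftrightarrow>
     \<phi> \<in> hom (cquot_group X) (cquot_group Y) \<and> holomorphic_map X Y \<phi>"

definition isogeny :: "cquot \<Rightarrow> cquot \<Rightarrow> (cvec set \<Rightarrow> cvec set) \<Rightarrow> bool" where
  "isogeny X Y \<phi> \<longleftrightarrow> holomorphic_hom X Y \<phi> \<and>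
     \<phi> ` carrier (cquot_group X) = carrier (cquot_group Y) \<and>
     finite (kernel (cquot_group X) (cquot_group Y) \<phi>)"

definition isogenous :: "cquot \<Rightarrow> cquot \<Rightarrow> bool" where
  "isogenous X Y \<longleftrightarrow> (\<exists>\<phi>. isogeny X Y \<phi>) \<or> (\<exists>\<phi>. isogeny Y X \<phi>)"

text \<open>
  The product of \<open>X 0, \<dots>, X (k - 1)\<close>: a vector of \<open>\<complex>\<^sup>N\<close>, with \<open>N\<close> the sum of the dimensions, is
  cut into consecutive blocks, and it is a period iff its \<open>i\<close>-th block is a period of \<open>X i\<close> for
  every \<open>i < k\<close>.
\<close>

definition block :: "nat \<Rightarrow> nat \<Rightarrow> cvec \<Rightarrow> cvec" where
  "block s d v = (\<Sum>j<d. Poly_Mapping.single j (Poly_Mapping.lookup v (s + j)))"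

lemma lookup_block:
  "Poly_Mapping.lookup (block s d v) i = (if i < d then Poly_Mapping.lookup v (s + i) else 0)"
  by (simp add: block_def lookup_sum lookup_single when_def)

definition cquot_prod :: "nat \<Rightarrow> (nat \<Rightarrow> cquot) \<Rightarrow> cquot" where
  "cquot_prod k X = \<lparr>
     cdim = (\<Sum>i<k. cdim (X i)),
     periods = {v \<in> Cn (\<Sum>i<k. cdim (X i)).
       \<forall>i<k. block (\<Sum>j<i. cdim (X j)) (cdim (X i)) v \<in> periods (X i)}\<rparr>"


section \<open>Toroidal groups\<close>

text \<open>
  The rank of a discrete subgroup \<open>\<Gamma>\<close> is the dimension of its real span, i.e. \<open>dim \<Gamma>\<close>. The
  condition \<open>m \<ge> 1\<close> excludes the zero group.
\<close>

definition toroidal :: "cquot \<Rightarrow> bool" where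
  "toroidal X \<longleftrightarrow> is_cquot X \<and>
     (\<exists>m. 1 \<le> m \<and> m \<le> cdim X \<and> dim (periods X) = cdim X + m) \<and>
     (\<forall>f. holomorphic_fun X f \<longrightarrow> (\<exists>c. \<forall>x\<in>carrier (cquot_group X). f x = c))"

text \<open>For a toroidal \<open>X\<close> this is the number \<open>m\<close> above, which is the complex dimension of
  the maximal complex subspace of the real span of the periods.\<close>

definition trank :: "cquot \<Rightarrow> nat" where
  "trank X = dim (periods X) - cdim X"

text \<open>
  A closed toroidal subgroup is a closed subgroup which, with its structure of a complex Lie
  subgroup, is toroidal: it is the image of an injective holomorphic homomorphism from a toroidal
  group (such a homomorphism is automatically an immersion, and an embedding if the image is
  closed). A set of cosets is closed in the quotient topology iff its union is closed in \<open>\<complex>\<^sup>n\<close>.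
\<close>

definition closed_toroidal_subgroup :: "cquot \<Rightarrow> cvec set set \<Rightarrow> bool" where
  "closed_toroidal_subgroup X K \<longleftrightarrow>
     subgroup K (cquot_group X) \<and> closedin (top_of_set (Cn (cdim X))) (\<Union>K) \<and>
     (\<exists>Z \<iota>. toroidal Z \<and> holomorphic_hom Z X \<iota> \<and>
        inj_on \<iota> (carrier (cquot_group Z)) \<and> \<iota> ` carrier (cquot_group Z) = K)"

definition geometrically_simple :: "cquot \<Rightarrow> bool" where
  "geometrically_simple X \<longleftrightarrow> toroidal X \<and>
     (\<forall>K. closed_toroidal_subgroup X K \<longrightarrow>
        K = carrier (cquot_group X) \<or> K = {\<one>\<^bsub>cquot_group X\<^esub>})"


section \<open>Quasi-abelian varieties\<close>

definition max_complex_subspace :: "cquot \<Rightarrow> cvec set" where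
  "max_complex_subspace X = span (periods X) \<inter> cscale \<i> ` span (periods X)"

definition hermitian_form :: "nat \<Rightarrow> (cvec \<Rightarrow> cvec \<Rightarrow> complex) \<Rightarrow> bool" where
  "hermitian_form n H \<longleftrightarrow>
     (\<forall>x\<in>Cn n. \<forall>y\<in>Cn n. \<forall>z\<in>Cn n. H (x + y) z = H x z + H y z) \<and>
     (\<forall>c. \<forall>x\<in>Cn n. \<forall>y\<in>Cn n. H (cscale c x) y = c * H x y) \<and>
     (\<forall>x\<in>Cn n. \<forall>y\<in>Cn n. H y x = cnj (H x y))"

definition ample_riemann_form :: "cquot \<Rightarrow> (cvec \<Rightarrow> cvec \<Rightarrow> complex) \<Rightarrow> bool" where
  "ample_riemann_form X H \<longleftrightarrow> hermitian_form (cdim X) H \<and>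
     (\<forall>v\<in>max_complex_subspace X. v \<noteq> 0 \<longrightarrow> Re (H v v) > 0) \<and>
     (\<forall>x\<in>periods X. \<forall>y\<in>periods X. Im (H x y) \<in> \<int>)"

text \<open>The rank of the alternating form \<open>Im H\<close> on the real span of \<open>\<Gamma>\<close> is the codimension of
  its radical.\<close>

definition form_rank :: "cquot \<Rightarrow> (cvec \<Rightarrow> cvec \<Rightarrow> complex) \<Rightarrow> nat" where
  "form_rank X H = dim (span (periods X)) -
     dim {x \<in> span (periods X). \<forall>y\<in>span (periods X). Im (H x y) = 0}"

definition form_kind :: "cquot \<Rightarrow> (cvec \<Rightarrow> cvec \<Rightarrow> complex) \<Rightarrow> nat \<Rightarrow> bool" where
  "form_kind X H k \<longleftrightarrow> form_rank X H = 2 * (trank X + k)"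

definition quasi_abelian :: "cquot \<Rightarrow> bool" where
  "quasi_abelian X \<longleftrightarrow> toroidal X \<and> (\<exists>H. ample_riemann_form X H)"

definition qa_kind :: "cquot \<Rightarrow> nat" where
  "qa_kind X = (LEAST k. \<exists>H. ample_riemann_form X H \<and> form_kind X H k)"

end

theory Submission
  imports Defs
begin

text \<open>
  The uniqueness is a Krull-Schmidt theorem in the category of the groups \<open>\<complex>\<^sup>n / \<Gamma>\<close> up to
  isogeny, whose morphisms are the complex linear maps sending \<open>\<Gamma>\<close> into a rational multiple of
  \<open>\<Gamma>'\<close>. The differential of an isogeny is an isomorphism in this category; conversely an isomorphism
  becomes an isogeny after multiplication by an integer, because subgroups of a discrete group
  with the same real span have finite index. If \<open>e\<close> is an idempotent endomorphism of \<open>X\<close>, its image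
  gives a closed subgroup, which is toroidal because \<open>e\<close> makes it a quotient of \<open>X\<close> up to isogeny.
  Hence a geometrically simple \<open>X\<close> has only the idempotents \<open>0\<close> and \<open>1\<close>. By Fitting's
  lemma every endomorphism of \<open>X\<close> is then nilpotent or invertible, so the endomorphism ring is local.
\<close>

section \<open>Complex linear maps between number spaces\<close>

text \<open>Closedness is the obstacle that shapes the proof. Geometric simplicity tests closed
  subgroups only, and in a noncompact group the image of an arbitrary endomorphism is not
  automatically closed, so Schur's argument on images is not at hand. For an idempotent
  \<open>e\<close> the image is controlled by 1 - \<open>e\<close>: modulo the image, the periods
  become the group (1 - \<open>e\<close>) applied to them, which is discrete because a multiple of
  it consists of periods. This is why the endomorphism ring is shown to be local and not a division
  ring, and why Fitting's lemma has to produce a rational idempotent and not just a linear one.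
  Being toroidal also includes a bound on the rank of the periods. For the image of \<open>e\<close>
  this bound is not inherited from X; it is recovered from the absence of nonconstant holomorphic
  functions. All number spaces lie in one infinite-dimensional real space, so a map counts only
  through its values on the relevant \<open>Cn n\<close>, and finite-dimensional arguments go
  through an explicit finite spanning set.\<close>

interpretation cvec: vector_space cscale
  by unfold_locales
    (auto intro!: poly_mapping_eqI simp: lookup_cscale lookup_add algebra_simps)

interpretation cvec_pair: vector_space_pair cscale cscale ..

text \<open>Linearity is imposed on the whole ambient type, while inverses and identities of maps
  are asserted only on some \<open>Cn n\<close>. The unqualified \<open>span\<close>,
  \<open>dim\<close> and \<open>independent\<close> refer to real scalars, those qualified by
  \<open>cvec\<close> to complex ones.\<close>

abbreviation clinear :: "(cvec \<Rightarrow> cvec) \<Rightarrow> bool" where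
  "clinear \<equiv> Vector_Spaces.linear cscale cscale"

lemma clinear_iff:
  "clinear f \<longleftrightarrow> (\<forall>x y. f (x + y) = f x + f y) \<and> (\<forall>c x. f (cscale c x) = cscale c (f x))"
  by (simp add: Vector_Spaces.linear_iff cvec.vector_space_axioms)

lemma lookup_scaleR: "Poly_Mapping.lookup (r *\<^sub>R v) i = r *\<^sub>R Poly_Mapping.lookup (v :: cvec) i"
  unfolding scaleR_poly_mapping_def
proof (subst lookup_Abs_poly_mapping)
  have "{x. r *\<^sub>R Poly_Mapping.lookup v x \<noteq> 0} \<subseteq> Poly_Mapping.keys v"
    by (auto simp: in_keys_iff)
  then show "finite {x. r *\<^sub>R Poly_Mapping.lookup v x \<noteq> 0}"
    by (rule finite_subset) simp
qed simp

lemma cscale_of_real: "cscale (of_real r) v = r *\<^sub>R v"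
  by (rule poly_mapping_eqI) (simp add: lookup_cscale lookup_scaleR scaleR_conv_of_real)

lemma clinear_imp_linear: "clinear f \<Longrightarrow> linear f"
  by (intro linearI) (auto simp: cvec_pair.linear_add cvec_pair.linear_scale simp flip: cscale_of_real)

lemma clinear_scaleR: "clinear f \<Longrightarrow> f (r *\<^sub>R v) = r *\<^sub>R f v"
  using clinear_imp_linear linear_scale by blast

lemma clinear_scaleR_left: "clinear f \<Longrightarrow> clinear (\<lambda>v. r *\<^sub>R f v)"
  using cvec_pair.linear_compose_scale_right[of f "of_real r"] by (simp add: cscale_of_real)

lemma Cn_iff: "v \<in> Cn n \<longleftrightarrow> (\<forall>i\<ge>n. Poly_Mapping.lookup v i = 0)"
  by (auto simp: Cn_def in_keys_iff subset_iff not_less) (meson not_less)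

lemma csubspace_Cn: "cvec.subspace (Cn n)"
  by (auto simp: cvec.subspace_def Cn_iff lookup_add lookup_cscale)

lemma subspace_Cn: "subspace (Cn n)"
  by (auto simp: subspace_def Cn_iff lookup_add lookup_scaleR)

lemmas zero_in_Cn [simp] = subspace_0[OF subspace_Cn]
lemmas Cn_add = subspace_add[OF subspace_Cn]
  and Cn_diff = subspace_diff[OF subspace_Cn]
  and Cn_neg = subspace_neg[OF subspace_Cn]
  and Cn_scaleR = subspace_scale[OF subspace_Cn]
  and Cn_sum = subspace_sum[OF subspace_Cn]
  and Cn_cscale = cvec.subspace_scale[OF csubspace_Cn]

lemma single_in_Cn: "i < n \<Longrightarrow> Poly_Mapping.single i c \<in> Cn n"
  by (auto simp: Cn_iff lookup_single when_def)

lemma Cn_expand: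
  assumes "v \<in> Cn n"
  shows "v = (\<Sum>i<n. cscale (Poly_Mapping.lookup v i) (Poly_Mapping.single i 1))"
  using assms
  by (intro poly_mapping_eqI)
     (auto simp: Cn_iff lookup_sum lookup_cscale lookup_single when_def if_distrib
           cong: if_cong)

text \<open>The set \<open>E\<close> carries the dimension arguments in the infinite-dimensional
  ambient space. It consists of the units and their multiples by the imaginary unit; its size later
  bounds the rank of a period group.\<close>

lemma Cn_real_span:
  obtains E where "finite E" "card E \<le> 2 * n" "Cn n \<subseteq> span E"
proof
  let ?e = "\<lambda>i. Poly_Mapping.single i (1 :: complex)"
  let ?f = "\<lambda>i. Poly_Mapping.single i \<i>"
  let ?E = "?e ` {..<n} \<union> ?f ` {..<n}"
  show "finite ?E" by simp
  have "card ?E \<le> card (?e ` {..<n}) + card (?f ` {..<n})" by (rule card_Un_le)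
  also have "\<dots> \<le> n + n" by (intro add_mono) (metis card_image_le card_lessThan finite_lessThan)+
  finally show "card ?E \<le> 2 * n" by simp
  show "Cn n \<subseteq> span ?E"
  proof
    fix v assume v: "v \<in> Cn n"
    have "cscale c (?e i) \<in> span ?E" if "i < n" for c i
    proof -
      have "cscale c (?e i) = Re c *\<^sub>R ?e i + Im c *\<^sub>R ?f i"
        by (rule poly_mapping_eqI)
           (auto simp: lookup_cscale lookup_add lookup_scaleR lookup_single when_def complex_eq_iff)
      moreover have "?e i \<in> ?E" "?f i \<in> ?E" using that by auto
      ultimately show ?thesis
        by (metis span_add span_scale span_base)
    qed
    then show "v \<in> span ?E"
      by (subst Cn_expand[OF v]) (auto intro: span_sum)
  qed
qed

section \<open>Norm, coordinates and compactness on the number spaces\<close>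

lemma norm_cvec:
  assumes "v \<in> Cn n"
  shows "norm v = (\<Sum>i<n. cmod (Poly_Mapping.lookup v i))"
proof -
  have "norm v = (\<Sum>i\<in>Poly_Mapping.keys v. cmod (Poly_Mapping.lookup v i))"
    by (simp add: norm_poly_mapping_def dist_poly_mapping_def)
  also have "\<dots> = (\<Sum>i<n. cmod (Poly_Mapping.lookup v i))"
    using assms by (intro sum.mono_neutral_left) (auto simp: Cn_def in_keys_iff)
  finally show ?thesis .
qed

lemma in_some_Cn: "\<exists>n. v \<in> Cn n"
proof -
  have "finite (Poly_Mapping.keys v)" by simp
  then obtain n where "Poly_Mapping.keys v \<subseteq> {..<n}"
    using finite_nat_iff_bounded by blast
  then show ?thesis by (auto simp: Cn_def)
qed

lemma norm_lookup_le: "cmod (Poly_Mapping.lookup (v :: cvec) i) \<le> norm v"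
proof (cases "i \<in> Poly_Mapping.keys v")
  case True
  have "norm v = (\<Sum>i\<in>Poly_Mapping.keys v. cmod (Poly_Mapping.lookup v i))"
    by (simp add: norm_poly_mapping_def dist_poly_mapping_def)
  with True show ?thesis
    using member_le_sum[of i "Poly_Mapping.keys v" "\<lambda>i. cmod (Poly_Mapping.lookup v i)"] by simp
next
  case False
  then show ?thesis by (simp add: in_keys_iff)
qed

lemma norm_single: "norm (Poly_Mapping.single i c :: cvec) = cmod c"
  by (auto simp: norm_poly_mapping_def dist_poly_mapping_def)

lemma bounded_linear_lookup: "bounded_linear (\<lambda>v :: cvec. Poly_Mapping.lookup v i)"
  by (rule bounded_linear_intro[where K = 1])
     (auto simp: lookup_add lookup_scaleR norm_lookup_le)

lemma bounded_linear_single: "bounded_linear (Poly_Mapping.single i :: complex \<Rightarrow> cvec)"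
  by (rule bounded_linear_intro[where K = 1])
     (auto simp: norm_single single_add lookup_scaleR lookup_single when_def
           intro!: poly_mapping_eqI)

lemma norm_cscale: "norm (cscale c v) = cmod c * norm v"
proof -
  obtain n where "v \<in> Cn n" using in_some_Cn by blast
  then show ?thesis
    by (simp add: norm_cvec[of _ n] Cn_cscale lookup_cscale norm_mult sum_distrib_left)
qed

lemma bounded_linear_cscale_left: "bounded_linear (\<lambda>c. cscale c v)"
  by (rule bounded_linear_intro[where K = "norm v"])
     (auto simp: cvec.scale_left_distrib norm_cscale lookup_scaleR lookup_cscale
           intro!: poly_mapping_eqI)

text \<open>The linear map whose columns are the vectors \<open>b i\<close>. It ignores all
  coordinates from \<open>n\<close> on, so it is bounded on the whole ambient space, which an
  arbitrary complex linear map need not be.\<close>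

definition lin_of :: "nat \<Rightarrow> (nat \<Rightarrow> cvec) \<Rightarrow> cvec \<Rightarrow> cvec" where
  "lin_of n b v = (\<Sum>i<n. cscale (Poly_Mapping.lookup v i) (b i))"

lemma clinear_lin_of: "clinear (lin_of n b)"
  by (simp add: clinear_iff lin_of_def lookup_add lookup_cscale
      cvec.scale_left_distrib sum.distrib cvec.scale_sum_right)

lemma lin_of_closed: "(\<And>i. i < n \<Longrightarrow> b i \<in> Cn p) \<Longrightarrow> lin_of n b v \<in> Cn p"
  by (auto simp: lin_of_def intro!: Cn_sum Cn_cscale)

lemma clinear_eq_lin_of:
  assumes "clinear f" "v \<in> Cn n"
  shows "f v = lin_of n (\<lambda>i. f (Poly_Mapping.single i 1)) v"
  by (subst Cn_expand[OF assms(2)])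
     (simp add: cvec_pair.linear_sum[OF assms(1)] cvec_pair.linear_scale[OF assms(1)] lin_of_def)

lemma bounded_linear_lin_of: "bounded_linear (lin_of n b)"
  unfolding lin_of_def
  by (intro bounded_linear_sum bounded_linear_compose[OF bounded_linear_cscale_left]
      bounded_linear_lookup)

lemma clinear_bound_Cn:
  assumes "clinear f"
  obtains K where "K > 0" "\<And>v. v \<in> Cn n \<Longrightarrow> norm (f v) \<le> K * norm v"
proof -
  obtain K where "K > 0"
    "\<And>v. norm (lin_of n (\<lambda>i. f (Poly_Mapping.single i 1)) v) \<le> norm v * K"
    using bounded_linear.pos_bounded[OF bounded_linear_lin_of] by blast
  then show ?thesis
    using clinear_eq_lin_of[OF assms] that by (metis mult.commute)
qed

lemma continuous_on_clinear:
  assumes "clinear f"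
  shows "continuous_on (Cn n) f"
proof -
  have "continuous_on (Cn n) (lin_of n (\<lambda>i. f (Poly_Mapping.single i 1)))"
    using bounded_linear_lin_of linear_continuous_on by blast
  then show ?thesis
    using clinear_eq_lin_of[OF assms] by (metis (no_types, lifting) continuous_on_cong)
qed

text \<open>The derivative is not given as \<open>f\<close> itself: a derivative must be bounded on
  the whole type, and \<open>f\<close> may be unbounded outside \<open>Cn n\<close>.\<close>

lemma has_derivative_clinear:
  assumes "clinear f" "z \<in> Cn n"
  shows "(f has_derivative lin_of n (\<lambda>i. f (Poly_Mapping.single i 1))) (at z within Cn n)"
proof -
  have "(lin_of n (\<lambda>i. f (Poly_Mapping.single i 1)) has_derivative
      lin_of n (\<lambda>i. f (Poly_Mapping.single i 1))) (at z within Cn n)"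
    by (rule bounded_linear_imp_has_derivative[OF bounded_linear_lin_of])
  then show ?thesis
    by (rule has_derivative_transform[rotated 2]) (use assms clinear_eq_lin_of in auto)
qed

text \<open>The ambient space is not locally compact, so compactness is built one coordinate at a
  time: a polydisc in dimension \<open>Suc n\<close> is the continuous image of a polydisc in
  dimension \<open>n\<close> times a closed disc.\<close>

lemma compact_Cn_coords:
  "compact {v \<in> Cn n. \<forall>i<n. cmod (Poly_Mapping.lookup v i) \<le> R}"
proof (induction n)
  case 0
  have "{v \<in> Cn 0. \<forall>i<0. cmod (Poly_Mapping.lookup v i) \<le> R} = {0}"
    by (auto simp: Cn_iff intro: poly_mapping_eqI)
  then show ?case by simp
next
  case (Suc n)
  let ?K = "\<lambda>n. {v \<in> Cn n. \<forall>i<n. cmod (Poly_Mapping.lookup v i) \<le> R}"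
  let ?f = "\<lambda>(v, c). v + Poly_Mapping.single n c :: cvec"
  have "compact (?K n \<times> cball (0 :: complex) R)"
    using Suc by (intro compact_Times) auto
  moreover have "continuous_on S ?f" for S :: "(cvec \<times> complex) set"
    unfolding case_prod_unfold
    by (intro continuous_intros linear_continuous_on_compose[OF _ bounded_linear.linear]
        bounded_linear.continuous_on[OF bounded_linear_single])
  ultimately have "compact (?f ` (?K n \<times> cball (0 :: complex) R))"
    by (rule compact_continuous_image[rotated])
  moreover have "?K (Suc n) = ?f ` (?K n \<times> cball 0 R)"
  proof (intro equalityI subsetI)
    fix v assume v: "v \<in> ?K (Suc n)"
    let ?c = "Poly_Mapping.lookup v n"
    have l: "Poly_Mapping.lookup (v - Poly_Mapping.single n ?c) i =
        (if i = n then 0 else Poly_Mapping.lookup v i)" for i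
      by (simp add: lookup_minus lookup_single when_def)
    have "v - Poly_Mapping.single n ?c \<in> Cn n"
      unfolding Cn_iff l using v by (simp add: Cn_iff)
    then have "v - Poly_Mapping.single n ?c \<in> ?K n"
      using v by (simp add: l)
    moreover have "?c \<in> cball 0 R" using v by simp
    moreover have "v = ?f (v - Poly_Mapping.single n ?c, ?c)" by simp
    ultimately show "v \<in> ?f ` (?K n \<times> cball 0 R)" by blast
  next
    fix v assume "v \<in> ?f ` (?K n \<times> cball 0 R)"
    then show "v \<in> ?K (Suc n)"
      by (auto simp: Cn_iff lookup_add lookup_single when_def less_Suc_eq)
  qed
  ultimately show ?case by simp
qed

lemma bounded_in_compact:
  obtains K where "compact K" "Cn n \<inter> cball 0 R \<subseteq> K"
proof
  show "Cn n \<inter> cball 0 R \<subseteq> {v \<in> Cn n. \<forall>i<n. cmod (Poly_Mapping.lookup v i) \<le> R}"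
    by (auto intro: order_trans[OF norm_lookup_le])
qed (rule compact_Cn_coords)

section \<open>Discrete subgroups\<close>

definition add_subgroup :: "'a::ab_group_add set \<Rightarrow> bool" where
  "add_subgroup G \<longleftrightarrow> 0 \<in> G \<and> (\<forall>x\<in>G. \<forall>y\<in>G. x - y \<in> G)"

lemma add_subgroup_0: "add_subgroup G \<Longrightarrow> 0 \<in> G"
  and add_subgroup_diff: "add_subgroup G \<Longrightarrow> x \<in> G \<Longrightarrow> y \<in> G \<Longrightarrow> x - y \<in> G"
  by (auto simp: add_subgroup_def)

lemma add_subgroup_uminus: "add_subgroup G \<Longrightarrow> x \<in> G \<Longrightarrow> - x \<in> G"
  by (metis add_subgroup_0 add_subgroup_diff diff_0)

lemma add_subgroup_add: "add_subgroup G \<Longrightarrow> x \<in> G \<Longrightarrow> y \<in> G \<Longrightarrow> x + y \<in> G"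
  by (metis add_subgroup_uminus add_subgroup_diff diff_minus_eq_add)

lemma add_subgroup_sum:
  "add_subgroup G \<Longrightarrow> (\<And>i. i \<in> I \<Longrightarrow> f i \<in> G) \<Longrightarrow> sum f I \<in> G"
  by (induction I rule: infinite_finite_induct) (auto simp: add_subgroup_0 add_subgroup_add)

lemma add_subgroup_nat:
  fixes x :: "'a :: real_vector"
  assumes "add_subgroup G" "x \<in> G"
  shows "real k *\<^sub>R x \<in> G"
  by (induction k) (auto simp: assms add_subgroup_0 add_subgroup_add scaleR_left_distrib)

lemma add_subgroup_int:
  fixes x :: "'a :: real_vector"
  assumes "add_subgroup G" "x \<in> G"
  shows "of_int k *\<^sub>R x \<in> G"
proof (cases "k \<ge> 0")
  case True
  then show ?thesis using add_subgroup_nat[OF assms, of "nat k"] by simp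
next
  case False
  then show ?thesis
    using add_subgroup_uminus[OF assms(1) add_subgroup_nat[OF assms, of "nat (- k)"]] by simp
qed

text \<open>By translation, a radius that isolates 0 separates any two points of the group, so
  discreteness is automatically uniform.\<close>

lemma discrete_subgroup_iff:
  fixes G :: "'a::real_normed_vector set"
  assumes "add_subgroup G"
  shows "discrete G \<longleftrightarrow> (\<exists>e>0. \<forall>x\<in>G. norm x < e \<longrightarrow> x = 0)"
proof
  assume "discrete G"
  then have "0 isolated_in G"
    using assms add_subgroup_0 by (auto simp: discrete_def)
  then show "\<exists>e>0. \<forall>x\<in>G. norm x < e \<longrightarrow> x = 0"
    by (auto simp: isolated_in_dist_Ex_iff dist_norm norm_minus_commute)
next
  assume "\<exists>e>0. \<forall>x\<in>G. norm x < e \<longrightarrow> x = 0"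
  then obtain e where "e > 0" "\<And>x. x \<in> G \<Longrightarrow> norm x < e \<Longrightarrow> x = 0" by blast
  then have "uniform_discrete G"
    unfolding uniform_discrete_def using assms add_subgroup_diff
    by (metis dist_norm eq_iff_diff_eq_0)
  then show "discrete G" by (rule uniform_discrete_imp_discrete)
qed

lemma uniform_discrete_subgroup:
  fixes G :: "'a::real_normed_vector set"
  assumes "add_subgroup G" "discrete G"
  shows "uniform_discrete G"
  unfolding uniform_discrete_def using assms add_subgroup_diff
  by (metis discrete_subgroup_iff dist_norm eq_iff_diff_eq_0)

text \<open>Multiplication by \<open>M\<close> is injective and scales norms by \<open>M\<close>, so
  a radius \<open>e\<close> for \<open>G\<close> gives the radius \<open>e / M\<close> for
  \<open>A\<close>. This serves groups that contain periods only up to a denominator.\<close>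

lemma discrete_of_multiple:
  fixes G A :: "'a::real_normed_vector set"
  assumes "add_subgroup A" "add_subgroup G" "discrete G" "M > 0"
    and M: "\<And>x. x \<in> A \<Longrightarrow> real M *\<^sub>R x \<in> G"
  shows "discrete A"
proof -
  obtain e where e: "e > 0" "\<And>x. x \<in> G \<Longrightarrow> norm x < e \<Longrightarrow> x = 0"
    using assms(2,3) discrete_subgroup_iff by metis
  have "x = 0" if "x \<in> A" "norm x < e / real M" for x
  proof -
    have "norm (real M *\<^sub>R x) < e"
      using that(2) assms(4) by (simp add: field_simps)
    then have "real M *\<^sub>R x = 0" by (rule e(2)[OF M[OF that(1)]])
    then show ?thesis using assms(4) by simp
  qed
  moreover have "e / real M > 0" using e(1) assms(4) by simp
  ultimately show ?thesis
    unfolding discrete_subgroup_iff[OF assms(1)] by blast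
qed

lemma finite_discrete_bounded:
  assumes "add_subgroup G" "discrete G" "G \<subseteq> Cn n"
  shows "finite (G \<inter> cball 0 R)"
proof -
  obtain K where K: "compact K" "Cn n \<inter> cball 0 R \<subseteq> K"
    by (rule bounded_in_compact)
  have "closed (G \<inter> cball 0 R)"
    using uniform_discrete_subgroup[OF assms(1,2)] uniform_discrete_imp_closed by auto
  then have "compact (K \<inter> (G \<inter> cball 0 R))"
    using K(1) compact_Int_closed by blast
  moreover have "K \<inter> (G \<inter> cball 0 R) = G \<inter> cball 0 R"
    using K assms(3) by blast
  moreover have "discrete (G \<inter> cball 0 R)"
    using assms(2) by (rule discrete_subset) auto
  ultimately show ?thesis
    using discrete_compact_finite_iff by metis
qed

lemma countable_discrete_subgroup:
  assumes "add_subgroup G" "discrete G" "G \<subseteq> Cn n"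
  shows "countable G"
proof -
  have "G = (\<Union>k. G \<inter> cball 0 (real k))"
    by (auto intro: real_arch_simple)
  moreover have "countable (\<Union>k. G \<inter> cball 0 (real k))"
    using finite_discrete_bounded[OF assms] by (intro countable_UN) (auto intro: countable_finite)
  ultimately show ?thesis by simp
qed

section \<open>Real lines, finite index and uniform torsion\<close>

lemma real_multiples_in_discrete_subgroup:
  fixes G :: "'a::real_normed_vector set"
  assumes "add_subgroup G" "discrete G" "\<And>t. t *\<^sub>R x \<in> G"
  shows "x = 0"
proof (rule ccontr)
  assume "x \<noteq> 0"
  obtain e where e: "e > 0" "\<And>x. x \<in> G \<Longrightarrow> norm x < e \<Longrightarrow> x = 0"
    using assms discrete_subgroup_iff by metis
  have "norm ((e / (2 * norm x)) *\<^sub>R x) < e" using e(1) \<open>x \<noteq> 0\<close> by simp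
  then have "(e / (2 * norm x)) *\<^sub>R x = 0" using e(2) assms(3) by blast
  then show False using e(1) \<open>x \<noteq> 0\<close> by simp
qed

text \<open>Pigeonhole on the multiples of \<open>x\<close> by 0, ..., \<open>card S\<close>: two of
  them have the same value under \<open>r\<close>, so some multiple by a number between 1 and
  \<open>card S\<close> lies in \<open>G\<close>. The factorial is divisible by all these numbers,
  hence serves every \<open>x\<close>. The map \<open>r\<close> is abstract because it is used once
  as a choice of coset representatives and once as the projection into the kernel of an
  isogeny.\<close>

lemma finite_cosets_imp_torsion:
  fixes r :: "'a::real_vector \<Rightarrow> 'b"
  assumes "\<And>x k. x \<in> A \<Longrightarrow> real k *\<^sub>R x \<in> A" and "finite S" "r ` A \<subseteq> S"
    and "\<And>x y. x \<in> A \<Longrightarrow> y \<in> A \<Longrightarrow> r x = r y \<Longrightarrow> x - y \<in> G" and "add_subgroup G"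
  shows "\<exists>M>0. \<forall>x\<in>A. real M *\<^sub>R x \<in> G"
proof (intro exI conjI ballI)
  show "0 < (fact (card S) :: nat)" by simp
next
  fix x assume x: "x \<in> A"
  let ?h = "\<lambda>k::nat. r (real k *\<^sub>R x)"
  have sub: "?h ` {..card S} \<subseteq> S" using assms(1,3) x by blast
  have "\<not> inj_on ?h {..card S}"
  proof
    assume "inj_on ?h {..card S}"
    then have "card {..card S} \<le> card S"
      using sub assms(2) card_inj_on_le by blast
    then show False by simp
  qed
  then obtain i j where ij: "i < j" "j \<le> card S" "?h i = ?h j"
    unfolding inj_on_def by (metis atMost_iff linorder_neqE_nat)
  then have "real j *\<^sub>R x - real i *\<^sub>R x \<in> G"
    using assms(1,4) x by metis
  then have "real (j - i) *\<^sub>R x \<in> G"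
    using ij(1) by (simp add: of_nat_diff scaleR_left_diff_distrib)
  moreover have "j - i dvd fact (card S)"
    using ij by (intro dvd_fact) auto
  then obtain c where "fact (card S) = (j - i) * c" by (rule dvdE)
  then have "real (fact (card S)) *\<^sub>R x = real c *\<^sub>R real (j - i) *\<^sub>R x"
    by (simp only: of_nat_mult scaleR_scaleR mult.commute)
  ultimately show "real (fact (card S)) *\<^sub>R x \<in> G"
    using assms(5) add_subgroup_nat by metis
qed

text \<open>Modulo integer combinations of a real basis taken from \<open>G1\<close>, every element
  of \<open>G\<close> moves into the fundamental parallelotope, which is bounded and thus meets the
  discrete group \<open>G\<close> in a finite set.\<close>

lemma finite_index_of_span:
  assumes "add_subgroup G1" "add_subgroup G" "discrete G" "G \<subseteq> Cn n" "G1 \<subseteq> G" "G \<subseteq> span G1"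
  shows "\<exists>S. finite S \<and> S \<subseteq> G \<and> (\<forall>x\<in>G. \<exists>s\<in>S. x - s \<in> G1)"
proof -
  obtain B where B: "B \<subseteq> G1" "independent B" "G1 \<subseteq> span B"
    using basis_exists by metis
  have "finite B"
  proof -
    obtain E where "finite E" "Cn n \<subseteq> span E"
      using Cn_real_span by metis
    then show ?thesis
      using B(1,2) assms(4,5) independent_span_bound[of E B] by blast
  qed
  have GB: "G \<subseteq> span B"
    using assms(6) B(3) by (meson order_trans span_minimal subspace_span)
  \<comment> \<open>The radius bounds every combination of \<open>B\<close> with coefficients in the
    interval from 0 to 1.\<close>
  define S where "S = G \<inter> cball 0 (\<Sum>b\<in>B. norm b)"
  show ?thesis
  proof (intro exI conjI ballI)
    show "finite S" unfolding S_def by (rule finite_discrete_bounded[OF assms(2-4)])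
    show "S \<subseteq> G" by (auto simp: S_def)
    fix x assume x: "x \<in> G"
    then obtain u where u: "x = (\<Sum>b\<in>B. u b *\<^sub>R b)"
      using GB \<open>finite B\<close> by (auto simp: span_finite)
    define y where "y = (\<Sum>b\<in>B. of_int \<lfloor>u b\<rfloor> *\<^sub>R b)"
    have y: "y \<in> G1"
      unfolding y_def using B(1) assms(1) by (intro add_subgroup_sum add_subgroup_int) auto
    have "x - y = (\<Sum>b\<in>B. frac (u b) *\<^sub>R b)"
      by (simp add: u y_def frac_def scaleR_left_diff_distrib sum_subtractf)
    moreover have "norm \<dots> \<le> (\<Sum>b\<in>B. norm b)"
      by (intro sum_norm_le) (auto simp: frac_lt_1 less_imp_le intro: mult_left_le_one_le)
    moreover have "x - y \<in> G"
      using x y assms(5) by (intro add_subgroup_diff[OF assms(2)]) auto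
    ultimately have "x - y \<in> S" by (simp add: S_def)
    moreover have "x - (x - y) \<in> G1" using y by simp
    ultimately show "\<exists>s\<in>S. x - s \<in> G1" by blast
  qed
qed

text \<open>The source of uniform denominators: \<open>M\<close> does not depend on
  \<open>x\<close>, as the definition of a rational homomorphism requires.\<close>

lemma torsion_of_span:
  assumes "add_subgroup G1" "add_subgroup G" "discrete G" "G \<subseteq> Cn n" "G1 \<subseteq> G" "G \<subseteq> span G1"
  shows "\<exists>M>0. \<forall>x\<in>G. real M *\<^sub>R x \<in> G1"
proof -
  obtain S where S: "finite S" "S \<subseteq> G" "\<forall>x\<in>G. \<exists>s\<in>S. x - s \<in> G1"
    using finite_index_of_span[OF assms] by blast
  then obtain r where r: "\<And>x. x \<in> G \<Longrightarrow> r x \<in> S \<and> x - r x \<in> G1" by metis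
  show ?thesis
  proof (rule finite_cosets_imp_torsion[of G S r G1])
    fix x y assume "x \<in> G" "y \<in> G" "r x = r y"
    then have "(x - r x) - (y - r x) \<in> G1"
      using r add_subgroup_diff[OF assms(1)] by metis
    then show "x - y \<in> G1" by simp
  qed (use S r assms add_subgroup_nat in auto)
qed

section \<open>Linear algebra in finitely generated subspaces\<close>

text \<open>The finite set \<open>E\<close> matters because \<open>dim\<close> is the cardinality of
  a basis and hence 0 for a space without a finite one.\<close>

lemma subspace_eq_of_dim:
  fixes S T :: "'a::real_vector set"
  assumes "finite E" "S \<subseteq> span E" "subspace T" "T \<subseteq> S" "dim S \<le> dim T"
  shows "T = S"
proof (rule ccontr)
  assume "T \<noteq> S"
  then obtain x where x: "x \<in> S" "x \<notin> T" using assms(4) by blast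
  obtain B where B: "B \<subseteq> T" "independent B" "T \<subseteq> span B" "card B = dim T"
    by (rule basis_exists)
  obtain C where C: "C \<subseteq> S" "independent C" "S \<subseteq> span C" "card C = dim S"
    by (rule basis_exists)
  have "span B \<subseteq> T" using B(1) assms(3) by (simp add: span_minimal)
  then have ins: "independent (insert x B)"
    using x B by (intro independent_insertI) auto
  have "finite C"
    using independent_span_bound[OF assms(1) C(2)] C(1) assms(2) by blast
  then have "finite (insert x B) \<and> card (insert x B) \<le> card C"
    using B(1) assms(4) x C(3) by (intro independent_span_bound ins) auto
  moreover have "x \<notin> B" using x B by blast
  ultimately show False using B(4) C(4) assms(5) by auto
qed

lemma linear_inj_on_imp_surj_on:
  fixes S :: "'a::real_vector set"
  assumes "finite E" "S \<subseteq> span E" "subspace S" "linear f" "inj_on f S" "f ` S \<subseteq> S"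
  shows "f ` S = S"
proof (rule subspace_eq_of_dim[OF assms(1,2)])
  obtain C where C: "C \<subseteq> S" "independent C" "S \<subseteq> span C" "card C = dim S"
    by (rule basis_exists)
  have "span C = S" using C assms(3) by (simp add: span_subspace)
  then have "independent (f ` C)"
    using linear_independent_injective_image[OF assms(4) C(2)] assms(5) by simp
  moreover have "span (f ` C) = f ` S"
    using linear_span_image[OF assms(4)] \<open>span C = S\<close> by simp
  ultimately have "dim (f ` S) = card (f ` C)"
    using dim_span_eq_card_independent by metis
  also have "card (f ` C) = dim S"
    using C(1,4) assms(5) by (metis card_image inj_on_subset)
  finally show "dim S \<le> dim (f ` S)" by simp
qed (use assms linear_subspace_image in auto)

text \<open>The image of a basis generates \<open>S\<close>, and a basis chosen inside this image
  already has \<open>dim S\<close> elements. So the image is itself independent and no two basis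
  vectors are identified.\<close>

lemma linear_surj_on_imp_inj_on:
  fixes S :: "'a::real_vector set"
  assumes "finite E" "S \<subseteq> span E" "subspace S" "linear f" "f ` S = S"
  shows "inj_on f S"
proof -
  obtain C where C: "C \<subseteq> S" "independent C" "S \<subseteq> span C" "card C = dim S"
    by (rule basis_exists)
  have sC: "span C = S" using C assms(3) by (simp add: span_subspace)
  have "finite C"
    using independent_span_bound[OF assms(1) C(2)] C(1) assms(2) by blast
  have sp: "span (f ` C) = S"
    using linear_span_image[OF assms(4)] sC assms(5) by simp
  obtain D where D: "D \<subseteq> f ` C" "independent D" "f ` C \<subseteq> span D"
    using basis_exists by metis
  have "span D = S"
    using D sp by (metis span_mono span_span subset_antisym)
  then have "card D = card C"
    using D(2) C(4) by (metis dim_span_eq_card_independent)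
  moreover have "card (f ` C) \<le> card C" using \<open>finite C\<close> card_image_le by blast
  ultimately have "D = f ` C" "card (f ` C) = card C"
    using D(1) \<open>finite C\<close> by (metis card_seteq finite_imageI card_mono le_antisym)+
  then have "inj_on f C" "independent (f ` C)"
    using D(2) \<open>finite C\<close> eq_card_imp_inj_on by auto
  then show ?thesis
    using linear_inj_on_span_independent_image[OF assms(4)] sC by metis
qed

section \<open>Krull-Schmidt\<close>

text \<open>
  An abstract additive category: objects \<open>x\<close> are given by carriers \<open>C x\<close>, morphisms are
  additive maps, considered only on the carriers.
\<close>

locale additive_category =
  fixes C :: "'o \<Rightarrow> 'a::ab_group_add set" and Hom :: "'o \<Rightarrow> 'o \<Rightarrow> ('a \<Rightarrow> 'a) \<Rightarrow> bool"
  assumes zero_in: "0 \<in> C x"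
    and hom_add: "Hom x y f \<Longrightarrow> f (u + v) = f u + f v"
    and hom_closed: "Hom x y f \<Longrightarrow> v \<in> C x \<Longrightarrow> f v \<in> C y"
    and hom_comp: "Hom x y f \<Longrightarrow> Hom y z g \<Longrightarrow> Hom x z (\<lambda>v. g (f v))"
    and hom_diff: "Hom x y f \<Longrightarrow> Hom x y g \<Longrightarrow> Hom x y (\<lambda>v. f v - g v)"
begin

section \<open>Units, local endomorphism rings and matrices of morphisms\<close>

lemma hom_additive: "Hom x y f \<Longrightarrow> Modules.additive f"
  by unfold_locales (rule hom_add)

lemma hom_zero: "Hom x y f \<Longrightarrow> f 0 = 0"
  and hom_minus: "Hom x y f \<Longrightarrow> f (u - v) = f u - f v"
  and hom_sum: "Hom x y f \<Longrightarrow> f (sum s A) = (\<Sum>i\<in>A. f (s i))"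
  using hom_additive Modules.additive.zero Modules.additive.diff Modules.additive.sum by blast+

definition inverse_pair :: "'o \<Rightarrow> 'o \<Rightarrow> ('a \<Rightarrow> 'a) \<Rightarrow> ('a \<Rightarrow> 'a) \<Rightarrow> bool" where
  "inverse_pair x y f g \<longleftrightarrow> Hom x y f \<and> Hom y x g \<and> (\<forall>v\<in>C x. g (f v) = v) \<and> (\<forall>v\<in>C y. f (g v) = v)"

definition invertible :: "'o \<Rightarrow> 'o \<Rightarrow> ('a \<Rightarrow> 'a) \<Rightarrow> bool" where
  "invertible x y f \<longleftrightarrow> (\<exists>g. inverse_pair x y f g)"

text \<open>The endomorphism ring is nonzero, and of \<open>a\<close> and 1 - \<open>a\<close> at
  least one is a unit: it is a local ring. That the identity is a morphism is demanded here because
  objects range over a whole type, on which the locale postulates no identities.\<close>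

definition local_object :: "'o \<Rightarrow> bool" where
  "local_object x \<longleftrightarrow> Hom x x (\<lambda>v. v) \<and> C x \<noteq> {0} \<and>
     (\<forall>a. Hom x x a \<longrightarrow> invertible x x a \<or> invertible x x (\<lambda>v. v - a v))"

lemma invertible_cong:
  "invertible x y f \<Longrightarrow> Hom x y f' \<Longrightarrow> (\<And>v. v \<in> C x \<Longrightarrow> f v = f' v) \<Longrightarrow> invertible x y f'"
  unfolding invertible_def inverse_pair_def by (metis hom_closed)

lemma invertible_comp:
  assumes "invertible x y f" "invertible y z g"
  shows "invertible x z (\<lambda>v. g (f v))"
proof -
  obtain f' g' where "inverse_pair x y f f'" "inverse_pair y z g g'"
    using assms invertible_def by blast
  then have "inverse_pair x z (\<lambda>v. g (f v)) (\<lambda>v. f' (g' v))"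
    unfolding inverse_pair_def by (auto intro: hom_comp simp: hom_closed)
  then show ?thesis using invertible_def by blast
qed

text \<open>Composing with the inverse \<open>s\<close> of the sum gives \<open>s a\<close> +
  \<open>s b\<close> = 1, to which locality applies directly.\<close>

lemma local_add:
  assumes "local_object x" "Hom x x a" "Hom x x b" "invertible x x (\<lambda>v. a v + b v)"
  shows "invertible x x a \<or> invertible x x b"
proof -
  obtain s where s: "inverse_pair x x (\<lambda>v. a v + b v) s"
    using assms(4) invertible_def by blast
  have inv: "invertible x x (\<lambda>v. a v + b v)" using assms(4) .
  have Hs: "Hom x x s" using s by (simp add: inverse_pair_def)
  \<comment> \<open>The way back from \<open>s c\<close> to \<open>c\<close>: on the carrier,
    \<open>c\<close> is the product of the unit \<open>a\<close> + \<open>b\<close> with the unit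
    \<open>s c\<close>.\<close>
  have cancel: "invertible x x c" if c: "Hom x x c" "invertible x x (\<lambda>v. s (c v))" for c
  proof (rule invertible_cong[OF invertible_comp[OF c(2) inv] c(1)])
    fix v assume "v \<in> C x"
    then show "a (s (c v)) + b (s (c v)) = c v"
      using s c(1) hom_closed unfolding inverse_pair_def by blast
  qed
  have "Hom x x (\<lambda>v. s (a v))" using assms(2) Hs by (rule hom_comp)
  then consider "invertible x x (\<lambda>v. s (a v))" | "invertible x x (\<lambda>v. v - s (a v))"
    using assms(1) unfolding local_object_def by blast
  then show ?thesis
  proof cases
    case 1
    then show ?thesis using cancel assms(2) by blast
  next
    case 2
    have "invertible x x (\<lambda>v. s (b v))"
    proof (rule invertible_cong[OF 2 hom_comp[OF assms(3) Hs]])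
      fix v assume "v \<in> C x"
      then have "s (a v + b v) = v" using s by (simp add: inverse_pair_def)
      then show "v - s (a v) = s (b v)" using hom_add[OF Hs] by (metis add_diff_cancel_left')
    qed
    then show ?thesis using cancel assms(3) by blast
  qed
qed

lemma not_invertible_zero:
  assumes "local_object x" "\<And>v. v \<in> C x \<Longrightarrow> f v = 0"
  shows "\<not> invertible x x f"
proof
  assume "invertible x x f"
  then obtain g where g: "Hom x x g" "\<And>v. v \<in> C x \<Longrightarrow> g (f v) = v"
    by (auto simp: invertible_def inverse_pair_def)
  then have "v = 0" if "v \<in> C x" for v
    using that assms(2) hom_zero by metis
  then show False using assms(1) zero_in by (auto simp: local_object_def)
qed

text \<open>The total is an arbitrary unit \<open>b\<close> and not the identity, since splitting
  off one summand in the induction replaces \<open>b\<close> by \<open>b\<close> -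
  \<open>a k\<close>.\<close>

lemma local_sum:
  assumes "local_object x" "finite J" "\<And>j. j \<in> J \<Longrightarrow> Hom x x (a j)"
    "invertible x x b" "Hom x x b" "\<And>v. v \<in> C x \<Longrightarrow> (\<Sum>j\<in>J. a j v) = b v"
  shows "\<exists>j\<in>J. invertible x x (a j)"
  using assms(2-)
proof (induction J arbitrary: b rule: finite_induct)
  case empty
  then have "\<not> invertible x x b"
    using not_invertible_zero[OF assms(1), of b] by simp
  then show ?case using empty by simp
next
  case (insert k J)
  let ?c = "\<lambda>v. b v - a k v"
  have c: "Hom x x ?c" using insert by (intro hom_diff) auto
  have "invertible x x (a k) \<or> invertible x x ?c"
    using insert.prems c by (intro local_add[OF assms(1)]) auto
  then show ?case
  proof
    assume "invertible x x ?c"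
    moreover have "(\<Sum>j\<in>J. a j v) = ?c v" if "v \<in> C x" for v
      using insert.prems(4)[OF that] insert.hyps by (simp add: algebra_simps)
    ultimately show ?thesis using insert.IH[of ?c] insert.prems c by auto
  qed auto
qed

text \<open>With \<open>s\<close> the inverse of \<open>g f\<close>, the map \<open>s g\<close> is a
  left inverse of \<open>f\<close>, so \<open>f s g\<close> is an idempotent endomorphism of
  \<open>y\<close>. A local ring has only the idempotents 0 and 1, and 0 would force the carrier of
  \<open>x\<close> to vanish.\<close>

lemma invertible_of_retract:
  assumes "local_object x" "local_object y" "Hom x y f" "Hom y x g" "invertible x x (\<lambda>v. g (f v))"
  shows "invertible x y f"
proof -
  obtain s where s: "inverse_pair x x (\<lambda>v. g (f v)) s"
    using assms(5) invertible_def by blast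
  then have Hs: "Hom x x s" by (simp add: inverse_pair_def)
  have sg: "Hom y x (\<lambda>v. s (g v))" by (rule hom_comp[OF assms(4) Hs])
  have sgf: "s (g (f v)) = v" if "v \<in> C x" for v using s that by (simp add: inverse_pair_def)
  let ?e = "\<lambda>v. f (s (g v))"
  have e: "Hom y y ?e" by (rule hom_comp[OF sg assms(3)])
  have idem: "?e (?e v) = ?e v" if "v \<in> C y" for v
    using sgf hom_closed[OF sg that] by simp
  have "invertible y y ?e \<or> invertible y y (\<lambda>v. v - ?e v)"
    using assms(2) e by (auto simp: local_object_def)
  then have "?e v = v" if v: "v \<in> C y" for v
  proof
    assume "invertible y y ?e"
    then obtain h where "Hom y y h" "\<And>v. v \<in> C y \<Longrightarrow> h (?e v) = v"
      by (auto simp: invertible_def inverse_pair_def)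
    then show ?thesis using idem hom_closed[OF e] v by metis
  next
    assume "invertible y y (\<lambda>v. v - ?e v)"
    then obtain h where h: "Hom y y h" "\<And>v. v \<in> C y \<Longrightarrow> h (v - ?e v) = v"
      by (auto simp: invertible_def inverse_pair_def)
    have zero: "?e v = 0" if "v \<in> C y" for v
      using h(2)[OF hom_closed[OF e that]] idem[OF that] hom_zero[OF h(1)] by simp
    have "v = 0" if "v \<in> C x" for v
    proof -
      have "f v = 0" using zero[OF hom_closed[OF assms(3) that]] sgf[OF that] by simp
      then show ?thesis using sgf[OF that] hom_zero[OF assms(4)] hom_zero[OF Hs] by simp
    qed
    then show ?thesis using assms(1) zero_in by (auto simp: local_object_def)
  qed
  then have "inverse_pair x y f (\<lambda>v. s (g v))"
    using assms(3) sg sgf by (simp add: inverse_pair_def)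
  then show ?thesis using invertible_def by blast
qed

text \<open>
  Mutually inverse matrices between two families of local objects. One entry \<open>f i\<^sub>0 j\<^sub>0\<close>
  is invertible; row and column are split off by passing to its Schur complement, whose inverse is
  the corresponding submatrix of \<open>g\<close>.
\<close>

lemma Krull_Schmidt:
  assumes "finite I" "finite J"
    and "\<And>i. i \<in> I \<Longrightarrow> local_object (A i)" and "\<And>j. j \<in> J \<Longrightarrow> local_object (B j)"
    and "\<And>i j. i \<in> I \<Longrightarrow> j \<in> J \<Longrightarrow> Hom (A i) (B j) (f i j)"
    and "\<And>i j. i \<in> I \<Longrightarrow> j \<in> J \<Longrightarrow> Hom (B j) (A i) (g j i)"
    and "\<And>i i' v. i \<in> I \<Longrightarrow> i' \<in> I \<Longrightarrow> v \<in> C (A i) \<Longrightarrow>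
      (\<Sum>j\<in>J. g j i' (f i j v)) = (if i = i' then v else 0)"
    and "\<And>j j' v. j \<in> J \<Longrightarrow> j' \<in> J \<Longrightarrow> v \<in> C (B j) \<Longrightarrow>
      (\<Sum>i\<in>I. f i j' (g j i v)) = (if j = j' then v else 0)"
  shows "\<exists>\<sigma>. bij_betw \<sigma> I J \<and> (\<forall>i\<in>I. \<exists>h. invertible (A i) (B (\<sigma> i)) h)"
  using assms
proof (induction I arbitrary: J f rule: finite_induct)
  case empty
  \<comment> \<open>Over the empty \<open>I\<close>, the identity of \<open>B j\<close> is an empty
    sum, although a local object is nonzero.\<close>
  have "J = {}"
  proof (rule ccontr)
    assume "J \<noteq> {}"
    then obtain j where j: "j \<in> J" by blast
    then have "v = 0" if "v \<in> C (B j)" for v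
      using empty.prems(7)[OF j j that] by simp
    then show False
      using empty.prems(3)[OF j] zero_in by (auto simp: local_object_def)
  qed
  then show ?case by (auto simp: bij_betw_def)
next
  case (insert i0 I)
  note prems = insert.prems
  have i0: "i0 \<in> insert i0 I" by simp
  have id: "Hom (A i0) (A i0) (\<lambda>v. v)" using prems(2)[OF i0] by (simp add: local_object_def)
  have "\<exists>j\<in>J. invertible (A i0) (A i0) (\<lambda>v. g j i0 (f i0 j v))"
  proof (rule local_sum[OF prems(2)[OF i0] prems(1)])
    show "invertible (A i0) (A i0) (\<lambda>v. v)"
      unfolding invertible_def inverse_pair_def using id by blast
    show "(\<Sum>j\<in>J. g j i0 (f i0 j v)) = v" if "v \<in> C (A i0)" for v
      using prems(6)[OF i0 i0 that] by simp
    show "Hom (A i0) (A i0) (\<lambda>v. g j i0 (f i0 j v))" if "j \<in> J" for j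
      using hom_comp[OF prems(4) prems(5)] i0 that by blast
  qed (rule id)
  then obtain j0 where j0: "j0 \<in> J" "invertible (A i0) (A i0) (\<lambda>v. g j0 i0 (f i0 j0 v))"
    by blast
  then have inv: "invertible (A i0) (B j0) (f i0 j0)"
    using invertible_of_retract[OF prems(2)[OF i0] prems(3) prems(4)[OF i0] prems(5)[OF i0]] by blast
  then obtain u where u: "inverse_pair (A i0) (B j0) (f i0 j0) u"
    using invertible_def by blast
  then have Hu: "Hom (B j0) (A i0) u" and fu: "\<And>v. v \<in> C (B j0) \<Longrightarrow> f i0 j0 (u v) = v"
    and uf: "\<And>v. v \<in> C (A i0) \<Longrightarrow> u (f i0 j0 v) = v"
    by (auto simp: inverse_pair_def)
  let ?f = "\<lambda>i j v. f i j v - f i0 j (u (f i j0 v))"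
  let ?J = "J - {j0}"
  have "\<exists>\<sigma>. bij_betw \<sigma> I ?J \<and> (\<forall>i\<in>I. \<exists>h. invertible (A i) (B (\<sigma> i)) h)"
  proof (rule insert.IH[of ?J ?f])
    fix i j assume "i \<in> I" "j \<in> ?J"
    then have ij: "i \<in> insert i0 I" "j \<in> J" by auto
    show "Hom (A i) (B j) (?f i j)"
      by (rule hom_diff[OF prems(4)[OF ij]
            hom_comp[OF hom_comp[OF prems(4)[OF ij(1) j0(1)] Hu] prems(4)[OF i0 ij(2)]]])
  next
    fix i i' v assume i: "i \<in> I" "i' \<in> I" and v: "v \<in> C (A i)"
    have ii: "i \<in> insert i0 I" "i' \<in> insert i0 I" using i by auto
    have ne: "i0 \<noteq> i'" using i insert.hyps by auto
    let ?w = "u (f i j0 v)"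
    have fv: "f i j0 v \<in> C (B j0)" using hom_closed[OF prems(4)[OF ii(1) j0(1)] v] .
    have w: "?w \<in> C (A i0)" by (rule hom_closed[OF Hu fv])
    have split: "(\<Sum>j\<in>?J. h j) = (\<Sum>j\<in>J. h j) - h j0" for h :: "_ \<Rightarrow> 'a"
      using prems(1) j0(1) by (simp add: sum_diff1)
    have "(\<Sum>j\<in>?J. g j i' (?f i j v)) = (\<Sum>j\<in>?J. g j i' (f i j v)) - (\<Sum>j\<in>?J. g j i' (f i0 j ?w))"
      using hom_minus[OF prems(5)[OF ii(2)]] by (simp add: sum_subtractf)
    \<comment> \<open>Both sums over the full \<open>J\<close> are known, the second being 0 because
      \<open>i0\<close> differs from \<open>i'\<close>. The two omitted \<open>j0\<close> terms
      cancel, as \<open>f i0 j0\<close> undoes \<open>u\<close>.\<close>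
    also have "\<dots> = (if i = i' then v else 0) - g j0 i' (f i j0 v) - (0 - g j0 i' (f i0 j0 ?w))"
      using prems(6)[OF ii v] prems(6)[OF i0 ii(2) w] ne by (simp only: split if_False)
    also have "f i0 j0 ?w = f i j0 v" by (rule fu[OF fv])
    finally show "(\<Sum>j\<in>?J. g j i' (?f i j v)) = (if i = i' then v else 0)" by simp
  next
    fix j j' v assume "j \<in> ?J" "j' \<in> ?J" and v: "v \<in> C (B j)"
    then have j: "j \<in> J" "j' \<in> J" "j \<noteq> j0" "j' \<noteq> j0" by auto
    have gv: "g j i0 v \<in> C (A i0)" using hom_closed[OF prems(5)[OF i0 j(1)] v] .
    have s: "(\<Sum>i\<in>I. f i j' (g j i v)) = (if j = j' then v else 0) - f i0 j' (g j i0 v)"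
      if "j' \<in> J" for j'
      using prems(7)[OF j(1) that v] insert.hyps by (simp add: algebra_simps)
    \<comment> \<open>The column \<open>j0\<close> sums to 0 over all of \<open>insert i0 I\<close>,
      because \<open>j\<close> differs from \<open>j0\<close>. The correction by \<open>u\<close>
      therefore restores exactly the summand \<open>i0\<close> missing from the first sum.\<close>
    have "(\<Sum>i\<in>I. ?f i j' (g j i v)) =
        (\<Sum>i\<in>I. f i j' (g j i v)) - f i0 j' (u (\<Sum>i\<in>I. f i j0 (g j i v)))"
      by (simp add: sum_subtractf hom_sum[OF prems(4)[OF i0 j(2)]] hom_sum[OF Hu])
    also have "(\<Sum>i\<in>I. f i j0 (g j i v)) = 0 - f i0 j0 (g j i0 v)"
      using s[OF j0(1)] j(3) by simp
    also have "u \<dots> = 0 - g j i0 v"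
      using hom_minus[OF Hu] hom_zero[OF Hu] uf[OF gv] by metis
    also have "f i0 j' \<dots> = 0 - f i0 j' (g j i0 v)"
      using hom_minus[OF prems(4)[OF i0 j(2)]] hom_zero[OF prems(4)[OF i0 j(2)]] by metis
    finally show "(\<Sum>i\<in>I. ?f i j' (g j i v)) = (if j = j' then v else 0)"
      using s[OF j(2)] by simp
  qed (use prems in auto)
  then obtain \<sigma> where \<sigma>: "bij_betw \<sigma> I ?J" "\<forall>i\<in>I. \<exists>h. invertible (A i) (B (\<sigma> i)) h" by blast
  have "bij_betw (\<sigma>(i0 := j0)) I ?J"
  proof -
    have "(\<sigma>(i0 := j0)) i = \<sigma> i" if "i \<in> I" for i using that insert.hyps(2) by auto
    then show ?thesis using \<sigma>(1) bij_betw_cong by blast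
  qed
  then have "bij_betw (\<sigma>(i0 := j0)) (I \<union> {i0}) (?J \<union> {j0})"
    by (rule bij_betw_combine) (auto simp: bij_betw_def)
  moreover have "I \<union> {i0} = insert i0 I" "?J \<union> {j0} = J" using j0(1) by auto
  ultimately have "bij_betw (\<sigma>(i0 := j0)) (insert i0 I) J" by simp
  moreover have "\<forall>i\<in>insert i0 I. \<exists>h. invertible (A i) (B ((\<sigma>(i0 := j0)) i)) h"
    using \<sigma>(2) inv by auto
  ultimately show ?case by blast
qed

end

section \<open>Rational homomorphisms and isogenies\<close>

lemma carrier_Cn_group [simp]: "carrier (Cn_group n) = Cn n"
  and mult_Cn_group [simp]: "x \<otimes>\<^bsub>Cn_group n\<^esub> y = x + y"
  and one_Cn_group [simp]: "\<one>\<^bsub>Cn_group n\<^esub> = 0"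
  by (simp_all add: Cn_group_def)

lemma inv_Cn_group: "x \<in> Cn n \<Longrightarrow> inv\<^bsub>Cn_group n\<^esub> x = - x"
proof -
  interpret comm_group "Cn_group n" by (rule comm_group_Cn)
  show "x \<in> Cn n \<Longrightarrow> ?thesis"
    by (intro inv_equality) (auto simp: Cn_neg)
qed

lemma subgroup_Cn_iff: "subgroup G (Cn_group n) \<longleftrightarrow> add_subgroup G \<and> G \<subseteq> Cn n"
proof
  assume G: "subgroup G (Cn_group n)"
  then have sub: "G \<subseteq> Cn n" using subgroup.subset by fastforce
  have "x - y \<in> G" if "x \<in> G" "y \<in> G" for x y
    using subgroup.m_closed[OF G that(1) subgroup.m_inv_closed[OF G that(2)]] inv_Cn_group sub that
    by auto
  then show "add_subgroup G \<and> G \<subseteq> Cn n"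
    using subgroup.one_closed[OF G] sub by (simp add: add_subgroup_def)
next
  assume "add_subgroup G \<and> G \<subseteq> Cn n"
  then show "subgroup G (Cn_group n)"
    by unfold_locales (auto simp: add_subgroup_add add_subgroup_0 subset_iff inv_Cn_group add_subgroup_uminus)
qed

lemma is_cquot_iff:
  "is_cquot X \<longleftrightarrow> add_subgroup (periods X) \<and> periods X \<subseteq> Cn (cdim X) \<and> discrete (periods X)"
  by (auto simp: is_cquot_def subgroup_Cn_iff)

lemma
  assumes "is_cquot X"
  shows add_subgroup_periods: "add_subgroup (periods X)"
    and periods_subset: "periods X \<subseteq> Cn (cdim X)"
    and discrete_periods: "discrete (periods X)"
  using assms by (auto simp: is_cquot_iff)

lemma cquot_proj_eq: "cquot_proj X z = (\<lambda>\<gamma>. \<gamma> + z) ` periods X"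
  by (auto simp: cquot_proj_def r_coset_def)

lemma cquot_proj_eq_iff:
  assumes "is_cquot X"
  shows "cquot_proj X z = cquot_proj X w \<longleftrightarrow> z - w \<in> periods X"
proof -
  note G = add_subgroup_periods[OF assms]
  have mem: "x \<in> cquot_proj X z \<longleftrightarrow> x - z \<in> periods X" for x z
    by (auto simp: cquot_proj_eq image_iff) (metis diff_add_cancel)
  show ?thesis
  proof
    assume "cquot_proj X z = cquot_proj X w"
    moreover have "z \<in> cquot_proj X z" using add_subgroup_0[OF G] by (simp add: mem)
    ultimately show "z - w \<in> periods X" using mem by blast
  next
    assume zw: "z - w \<in> periods X"
    have "x - z \<in> periods X \<longleftrightarrow> x - w \<in> periods X" for x
      using add_subgroup_add[OF G _ zw, of "x - z"] add_subgroup_diff[OF G _ zw, of "x - w"] by auto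
    then show "cquot_proj X z = cquot_proj X w" using mem by blast
  qed
qed

lemma in_cquot_proj: "is_cquot X \<Longrightarrow> z \<in> cquot_proj X z"
  by (force simp: cquot_proj_eq image_iff dest: add_subgroup_periods add_subgroup_0)

lemma carrier_cquot_group: "carrier (cquot_group X) = cquot_proj X ` Cn (cdim X)"
  by (auto simp: cquot_group_def FactGroup_def RCOSETS_def cquot_proj_def)

lemma one_cquot_group: "\<one>\<^bsub>cquot_group X\<^esub> = cquot_proj X 0"
  by (simp add: cquot_group_def FactGroup_def cquot_proj_eq)

lemma mult_cquot_group:
  assumes "is_cquot X"
  shows "cquot_proj X z \<otimes>\<^bsub>cquot_group X\<^esub> cquot_proj X w = cquot_proj X (z + w)"
proof -
  note G = add_subgroup_periods[OF assms]
  have "cquot_proj X z \<otimes>\<^bsub>cquot_group X\<^esub> cquot_proj X w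
      = {(a + z) + (b + w) | a b. a \<in> periods X \<and> b \<in> periods X}"
    by (auto simp: cquot_group_def FactGroup_def set_mult_def cquot_proj_eq)
  also have "\<dots> = cquot_proj X (z + w)"
  proof (intro equalityI subsetI)
    fix x assume "x \<in> {(a + z) + (b + w) | a b. a \<in> periods X \<and> b \<in> periods X}"
    then obtain a b where "a \<in> periods X" "b \<in> periods X" "x = (a + b) + (z + w)"
      by (auto simp: add_ac)
    then show "x \<in> cquot_proj X (z + w)"
      using add_subgroup_add[OF G] by (auto simp: cquot_proj_eq)
  next
    fix x assume "x \<in> cquot_proj X (z + w)"
    then obtain a where "a \<in> periods X" "x = (a + z) + (0 + w)"
      by (auto simp: cquot_proj_eq add_ac)
    then show "x \<in> {(a + z) + (b + w) | a b. a \<in> periods X \<and> b \<in> periods X}"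
      using add_subgroup_0[OF G] by blast
  qed
  finally show ?thesis .
qed

lemma group_cquot_group:
  assumes "is_cquot X"
  shows "group (cquot_group X)"
proof -
  interpret comm_group "Cn_group (cdim X)" by (rule comm_group_Cn)
  show ?thesis
    unfolding cquot_group_def using assms is_cquot_def subgroup_imp_normal normal.factorgroup_is_group
    by blast
qed

section \<open>Homomorphisms induced by linear maps\<close>

definition induced_map :: "cquot \<Rightarrow> (cvec \<Rightarrow> cvec) \<Rightarrow> cvec set \<Rightarrow> cvec set" where
  "induced_map Y L K = cquot_proj Y (L (SOME v. v \<in> K))"

lemma induced_map_proj:
  assumes "is_cquot X" "is_cquot Y" "clinear L" "L ` periods X \<subseteq> periods Y"
  shows "induced_map Y L (cquot_proj X v) = cquot_proj Y (L v)"
proof -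
  define w where "w = (SOME w. w \<in> cquot_proj X v)"
  have "w \<in> cquot_proj X v"
    unfolding w_def using in_cquot_proj[OF assms(1)] by (rule someI)
  then have "w - v \<in> periods X" by (auto simp: cquot_proj_eq)
  then have "L w - L v \<in> periods Y"
    using assms(4) cvec_pair.linear_diff[OF assms(3)] by (metis image_subset_iff)
  then show ?thesis
    by (simp add: induced_map_def w_def cquot_proj_eq_iff[OF assms(2)])
qed

lemma holomorphic_hom_induced_map:
  assumes "is_cquot X" "is_cquot Y" "clinear L" "L ` periods X \<subseteq> periods Y"
    and "L ` Cn (cdim X) \<subseteq> Cn (cdim Y)"
  shows "holomorphic_hom X Y (induced_map Y L)"
  unfolding holomorphic_hom_def
proof
  note ind = induced_map_proj[OF assms(1-4)]
  show "induced_map Y L \<in> hom (cquot_group X) (cquot_group Y)"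
    using assms(5)
    by (auto simp: hom_def carrier_cquot_group ind mult_cquot_group assms(1,2)
        cvec_pair.linear_add[OF assms(3)])
  show "holomorphic_map X Y (induced_map Y L)"
    unfolding holomorphic_map_def
  proof (intro ballI exI conjI)
    show "holomorphic_map_Cn (cdim X) (cdim Y) L (Cn (cdim X))"
      unfolding holomorphic_map_Cn_def holomorphic_Cn_def
    proof (intro conjI allI impI ballI exI)
      fix z j assume "z \<in> Cn (cdim X)"
      then show "((\<lambda>z. Poly_Mapping.lookup (L z) j) has_derivative
          (\<lambda>v. Poly_Mapping.lookup (lin_of (cdim X) (\<lambda>i. L (Poly_Mapping.single i 1)) v) j))
          (at z within Cn (cdim X))"
        by (rule bounded_linear.has_derivative[OF bounded_linear_lookup has_derivative_clinear[OF assms(3)]])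
    next
      fix j z c v assume "z \<in> Cn (cdim X)" "v \<in> Cn (cdim X)"
      show "Poly_Mapping.lookup (lin_of (cdim X) (\<lambda>i. L (Poly_Mapping.single i 1)) (cscale c v)) j =
          c * Poly_Mapping.lookup (lin_of (cdim X) (\<lambda>i. L (Poly_Mapping.single i 1)) v) j"
        by (simp add: cvec_pair.linear_scale[OF clinear_lin_of] lookup_cscale)
    qed (use assms(5) in auto)
  qed (use ind in auto)
qed

section \<open>The isogeny category and its isomorphisms\<close>

text \<open>Homomorphisms with rational coefficients, represented by their differentials; a single
  \<open>N\<close> clears the denominators on all periods. The conditions \<open>is_cquot\<close>
  allow the objects to range over the whole record type.\<close>

definition qhom :: "cquot \<Rightarrow> cquot \<Rightarrow> (cvec \<Rightarrow> cvec) \<Rightarrow> bool" where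
  "qhom X Y L \<longleftrightarrow> is_cquot X \<and> is_cquot Y \<and> clinear L \<and> L ` Cn (cdim X) \<subseteq> Cn (cdim Y) \<and>
     (\<exists>N>0. \<forall>\<gamma>\<in>periods X. real N *\<^sub>R L \<gamma> \<in> periods Y)"

lemma qhom_id: "is_cquot X \<Longrightarrow> qhom X X (\<lambda>v. v)"
  by (auto simp: qhom_def clinear_iff intro!: exI[of _ 1])

interpretation qhom: additive_category "\<lambda>X. Cn (cdim X)" qhom
proof
  fix x y z :: cquot and f g
  show "0 \<in> Cn (cdim x)" by simp
  show "f (u + v) = f u + f v" if "qhom x y f" for u v
    using that by (simp add: qhom_def cvec_pair.linear_add)
  show "f v \<in> Cn (cdim y)" if "qhom x y f" "v \<in> Cn (cdim x)" for v
    using that by (auto simp: qhom_def)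
  show "qhom x z (\<lambda>v. g (f v))" if f: "qhom x y f" and g: "qhom y z g"
  proof -
    obtain N M where N: "N > 0" "\<And>\<gamma>. \<gamma> \<in> periods x \<Longrightarrow> real N *\<^sub>R f \<gamma> \<in> periods y"
      and M: "M > 0" "\<And>\<gamma>. \<gamma> \<in> periods y \<Longrightarrow> real M *\<^sub>R g \<gamma> \<in> periods z"
      using f g unfolding qhom_def by metis
    have lin: "clinear f" "clinear g" using f g by (auto simp: qhom_def)
    have "clinear (\<lambda>v. g (f v))"
      using lin by (simp add: clinear_iff)
    moreover have "real (M * N) *\<^sub>R g (f \<gamma>) \<in> periods z" if "\<gamma> \<in> periods x" for \<gamma>
      using M(2)[OF N(2)[OF that]] clinear_scaleR[OF lin(2)] by simp
    moreover have "M * N > 0" using N(1) M(1) by simp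
    ultimately show ?thesis using f g unfolding qhom_def by blast
  qed
  show "qhom x y (\<lambda>v. f v - g v)" if f: "qhom x y f" and g: "qhom x y g"
  proof -
    obtain N M where N: "N > 0" "\<And>\<gamma>. \<gamma> \<in> periods x \<Longrightarrow> real N *\<^sub>R f \<gamma> \<in> periods y"
      and M: "M > 0" "\<And>\<gamma>. \<gamma> \<in> periods x \<Longrightarrow> real M *\<^sub>R g \<gamma> \<in> periods y"
      using f g unfolding qhom_def by metis
    have y: "add_subgroup (periods y)" using f by (simp add: qhom_def is_cquot_iff)
    have "clinear (\<lambda>v. f v - g v)"
      using f g by (simp add: qhom_def cvec_pair.linear_compose_sub)
    moreover have "real (M * N) *\<^sub>R (f \<gamma> - g \<gamma>) \<in> periods y" if "\<gamma> \<in> periods x" for \<gamma>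
    proof -
      have "real M *\<^sub>R (real N *\<^sub>R f \<gamma>) - real N *\<^sub>R (real M *\<^sub>R g \<gamma>) \<in> periods y"
        by (rule add_subgroup_diff[OF y add_subgroup_nat[OF y N(2)[OF that]]
              add_subgroup_nat[OF y M(2)[OF that]]])
      then show ?thesis by (simp add: scaleR_diff_right mult.commute)
    qed
    moreover have "M * N > 0" using N(1) M(1) by simp
    moreover have "(\<lambda>v. f v - g v) ` Cn (cdim x) \<subseteq> Cn (cdim y)"
      using f g by (auto simp: qhom_def intro!: Cn_diff)
    ultimately show ?thesis using f g unfolding qhom_def by blast
  qed
qed

text \<open>Clearing the denominator \<open>N\<close> of \<open>L\<close> yields a genuine
  homomorphism, whose kernel is the preimage \<open>?A\<close> of the periods of \<open>Y\<close>
  modulo the periods of \<open>X\<close>. The inverse \<open>T\<close> shows that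
  \<open>N * M\<close> times \<open>?A\<close> consists of periods of \<open>X\<close>. So
  \<open>?A\<close> is discrete with the same real span, and the periods have finite index in
  it.\<close>

lemma invertible_imp_isogenous:
  assumes "qhom.invertible X Y L"
  shows "isogenous X Y"
proof -
  obtain T where T: "qhom X Y L" "qhom Y X T" "\<And>v. v \<in> Cn (cdim X) \<Longrightarrow> T (L v) = v"
    "\<And>v. v \<in> Cn (cdim Y) \<Longrightarrow> L (T v) = v"
    using assms by (auto simp: qhom.invertible_def qhom.inverse_pair_def)
  have X: "is_cquot X" and Y: "is_cquot Y" and L: "clinear L" and T': "clinear T"
    using T by (auto simp: qhom_def)
  obtain N where N: "N > 0" "\<And>\<gamma>. \<gamma> \<in> periods X \<Longrightarrow> real N *\<^sub>R L \<gamma> \<in> periods Y"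
    using T(1) unfolding qhom_def by metis
  obtain M where M: "M > 0" "\<And>\<gamma>. \<gamma> \<in> periods Y \<Longrightarrow> real M *\<^sub>R T \<gamma> \<in> periods X"
    using T(2) unfolding qhom_def by metis
  let ?F = "\<lambda>v. real N *\<^sub>R L v"
  have F: "clinear ?F" using clinear_scaleR_left[OF L] .
  have FC: "?F ` Cn (cdim X) \<subseteq> Cn (cdim Y)" using T(1) by (auto simp: qhom_def intro!: Cn_scaleR)
  have FP: "?F ` periods X \<subseteq> periods Y" using N(2) by auto
  note ind = induced_map_proj[OF X Y F FP]
  let ?A = "{v \<in> Cn (cdim X). ?F v \<in> periods Y}"
  have A: "add_subgroup ?A"
    unfolding add_subgroup_def
    using add_subgroup_periods[OF Y] cvec_pair.linear_0[OF F] cvec_pair.linear_diff[OF F]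
    by (auto simp: add_subgroup_0 add_subgroup_diff Cn_diff)
  have sub: "periods X \<subseteq> ?A" using FP periods_subset[OF X] by auto
  have tors: "real (N * M) *\<^sub>R v \<in> periods X" if "v \<in> ?A" for v
  proof -
    have "real M *\<^sub>R T (?F v) \<in> periods X" using that M(2) by blast
    moreover have "T (?F v) = real N *\<^sub>R v"
      using that T(3) clinear_scaleR[OF T'] by simp
    ultimately show ?thesis by (simp add: mult.commute)
  qed
  have "N * M > 0" using N(1) M(1) by simp
  then have disc: "discrete ?A"
    by (rule discrete_of_multiple[OF A add_subgroup_periods[OF X] discrete_periods[OF X] _ tors])
  have spn: "?A \<subseteq> span (periods X)"
  proof
    fix v assume "v \<in> ?A"
    then have "(1 / real (N * M)) *\<^sub>R (real (N * M) *\<^sub>R v) \<in> span (periods X)"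
      by (intro span_scale span_base tors)
    then show "v \<in> span (periods X)" using N(1) M(1) by simp
  qed
  have "?A \<subseteq> Cn (cdim X)" by blast
  from finite_index_of_span[OF add_subgroup_periods[OF X] A disc this sub spn]
  obtain S where S: "finite S" "\<And>x. x \<in> ?A \<Longrightarrow> \<exists>s\<in>S. x - s \<in> periods X"
    by auto
  have "kernel (cquot_group X) (cquot_group Y) (induced_map Y ?F) \<subseteq> cquot_proj X ` S"
  proof
    fix K assume "K \<in> kernel (cquot_group X) (cquot_group Y) (induced_map Y ?F)"
    then obtain v where v: "v \<in> Cn (cdim X)" "K = cquot_proj X v" "cquot_proj Y (?F v) = cquot_proj Y 0"
      by (auto simp: kernel_def carrier_cquot_group one_cquot_group ind)
    then have "v \<in> ?A" using cquot_proj_eq_iff[OF Y] by simp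
    then show "K \<in> cquot_proj X ` S"
      using S(2) v(2) cquot_proj_eq_iff[OF X] by blast
  qed
  then have "finite (kernel (cquot_group X) (cquot_group Y) (induced_map Y ?F))"
    using S(1) finite_surj by blast
  moreover have "induced_map Y ?F ` carrier (cquot_group X) = carrier (cquot_group Y)"
  proof -
    have "?F ` Cn (cdim X) = Cn (cdim Y)"
    proof (intro equalityI subsetI)
      fix w assume w: "w \<in> Cn (cdim Y)"
      let ?v = "(1 / real N) *\<^sub>R T w"
      have "T w \<in> Cn (cdim X)" using T(2) w qhom.hom_closed by blast
      then have "?v \<in> Cn (cdim X)" by (rule Cn_scaleR)
      moreover have "?F ?v = w" using N(1) T(4)[OF w] clinear_scaleR[OF L] by simp
      ultimately show "w \<in> ?F ` Cn (cdim X)" by (metis imageI)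
    qed (use FC in auto)
    then show ?thesis by (simp add: carrier_cquot_group image_image ind flip: image_image[of "cquot_proj Y" ?F])
  qed
  ultimately have "isogeny X Y (induced_map Y ?F)"
    using holomorphic_hom_induced_map[OF X Y F FP FC] by (simp add: isogeny_def)
  then show ?thesis by (auto simp: isogenous_def)
qed

text \<open>
  A local lift of the homomorphism at \<open>0\<close> is additive near \<open>0\<close> by discreteness of the periods, so it
  coincides there with its derivative, which is the complex linear lift.
\<close>

lemma holomorphic_hom_lift:
  assumes X: "is_cquot X" and Y: "is_cquot Y" and \<phi>: "holomorphic_hom X Y \<phi>"
  shows "\<exists>L. clinear L \<and> L ` Cn (cdim X) \<subseteq> Cn (cdim Y) \<and> L ` periods X \<subseteq> periods Y \<and>
    (\<forall>v\<in>Cn (cdim X). \<phi> (cquot_proj X v) = cquot_proj Y (L v))"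
proof -
  define n p where "n = cdim X" and "p = cdim Y"
  have hom: "\<phi> \<in> hom (cquot_group X) (cquot_group Y)" and map: "holomorphic_map X Y \<phi>"
    using \<phi> by (auto simp: holomorphic_hom_def)
  have "\<exists>U F. openin (top_of_set (Cn n)) U \<and> 0 \<in> U \<and> holomorphic_map_Cn n p F U \<and>
      (\<forall>w\<in>U. \<phi> (cquot_proj X w) = cquot_proj Y (F w))"
    using map unfolding holomorphic_map_def n_def p_def by (auto dest: bspec[of _ _ 0])
  then obtain U F where U: "openin (top_of_set (Cn n)) U" "0 \<in> U"
    and F: "holomorphic_map_Cn n p F U"
    and \<phi>F: "\<And>w. w \<in> U \<Longrightarrow> \<phi> (cquot_proj X w) = cquot_proj Y (F w)"
    by blast
  obtain e0 where e0: "e0 > 0" "\<And>w. w \<in> Cn n \<Longrightarrow> norm w < e0 \<Longrightarrow> w \<in> U"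
    using U unfolding openin_contains_ball by (force simp: dist_norm)
  obtain e1 where e1: "e1 > 0" "\<And>x. x \<in> periods Y \<Longrightarrow> norm x < e1 \<Longrightarrow> x = 0"
    using Y is_cquot_iff discrete_subgroup_iff by metis
  have FU: "F w \<in> Cn p" if "w \<in> U" for w
    using F that by (auto simp: holomorphic_map_Cn_def)
  have "\<forall>j<p. \<exists>D. ((\<lambda>z. Poly_Mapping.lookup (F z) j) has_derivative D) (at 0 within Cn n) \<and>
      (\<forall>c. \<forall>v\<in>Cn n. D (cscale c v) = c * D v)"
    using F U(2) by (auto simp: holomorphic_map_Cn_def holomorphic_Cn_def)
  then obtain D where
    D: "\<And>j. j < p \<Longrightarrow> ((\<lambda>z. Poly_Mapping.lookup (F z) j) has_derivative D j) (at 0 within Cn n)"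
    and Dc: "\<And>j c v. j < p \<Longrightarrow> v \<in> Cn n \<Longrightarrow> D j (cscale c v) = c * D j v"
    by metis
  have \<phi>mult: "\<phi> (cquot_proj X (u + w)) = \<phi> (cquot_proj X u) \<otimes>\<^bsub>cquot_group Y\<^esub> \<phi> (cquot_proj X w)"
    if "u \<in> Cn n" "w \<in> Cn n" for u w
    using hom that by (auto simp: hom_def carrier_cquot_group n_def simp flip: mult_cquot_group[OF X])
  have \<phi>0: "\<phi> (cquot_proj X 0) = cquot_proj Y 0"
    using hom_one[OF hom group_cquot_group[OF X] group_cquot_group[OF Y]] by (simp add: one_cquot_group)
  have F0: "F 0 \<in> periods Y"
    using \<phi>F[OF U(2)] \<phi>0 cquot_proj_eq_iff[OF Y, of "F 0" 0] by simp
  \<comment> \<open>The value \<open>F 0\<close> is a period, so subtracting it gives another local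
    lift, now vanishing at 0.\<close>
  define G where "G w = F w - F 0" for w
  have \<phi>G: "\<phi> (cquot_proj X w) = cquot_proj Y (G w)" if "w \<in> U" for w
    using \<phi>F[OF that] F0 cquot_proj_eq_iff[OF Y, of "F w" "G w"] by (simp add: G_def)
  have GC: "G w \<in> Cn p" if "w \<in> U" for w
    unfolding G_def using FU that U(2) by (intro Cn_diff) auto

  \<comment> \<open>By the formula for the norm, the sum is the norm of \<open>F w\<close> -
    \<open>F 0\<close>. The later bound \<open>e1 / 3\<close> leaves room for the three terms of the
    additivity defect of \<open>G\<close>.\<close>
  have "((\<lambda>w. \<Sum>j<p. cmod (Poly_Mapping.lookup (F w) j - Poly_Mapping.lookup (F 0) j)) \<longlongrightarrow>
      (\<Sum>j<p. cmod (Poly_Mapping.lookup (F 0) j - Poly_Mapping.lookup (F 0) j))) (at 0 within Cn n)"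
    using has_derivative_continuous[OF D]
    by (intro tendsto_sum tendsto_norm tendsto_diff tendsto_const) (auto simp: continuous_within)
  then have "\<forall>\<^sub>F w in at 0 within Cn n.
      (\<Sum>j<p. cmod (Poly_Mapping.lookup (F w) j - Poly_Mapping.lookup (F 0) j)) < e1 / 3"
    using e1(1) by (intro order_tendstoD(2)[where a = "e1 / 3"]) auto
  then obtain d1 where d1: "d1 > 0" "\<And>w. w \<in> Cn n \<Longrightarrow> w \<noteq> 0 \<Longrightarrow> norm w < d1 \<Longrightarrow>
      (\<Sum>j<p. cmod (Poly_Mapping.lookup (F w) j - Poly_Mapping.lookup (F 0) j)) < e1 / 3"
    unfolding eventually_at by (auto simp: dist_norm)
  \<comment> \<open>Halved so that the sum of two vectors of norm below \<open>d\<close> stays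
    within both radii \<open>d1\<close> and \<open>e0\<close>.\<close>
  define d where "d = min d1 e0 / 2"
  have d: "d > 0" using d1(1) e0(1) by (simp add: d_def)
  have small: "w \<in> U" if "w \<in> Cn n" "norm w < 2 * d" for w
    using e0(2) that by (simp add: d_def)
  have Gsmall: "norm (G w) < e1 / 3" if "w \<in> Cn n" "norm w < 2 * d" for w
  proof (cases "w = 0")
    case False
    then show ?thesis
      using d1(2)[of w] that norm_cvec[OF GC[OF small[OF that]]] by (simp add: d_def G_def lookup_minus)
  qed (use e1 in \<open>simp add: G_def\<close>)
  have Gadd: "G (u + w) = G u + G w"
    if u: "u \<in> Cn n" "norm u < d" and w: "w \<in> Cn n" "norm w < d" for u w
  proof -
    have uw: "u + w \<in> Cn n" "norm (u + w) < 2 * d"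
      using u w Cn_add norm_triangle_ineq[of u w] by auto
    have 2: "norm u < 2 * d" "norm w < 2 * d" using u w d by auto
    have "cquot_proj Y (G (u + w)) = cquot_proj Y (G u + G w)"
      using \<phi>mult[OF u(1) w(1)] \<phi>G small uw u(1) w(1) 2 by (simp add: mult_cquot_group[OF Y])
    then have "G (u + w) - (G u + G w) \<in> periods Y"
      using cquot_proj_eq_iff[OF Y] by blast
    moreover have "norm (G (u + w) - (G u + G w)) < e1"
    proof -
      have "norm (G (u + w) - (G u + G w)) \<le> norm (G (u + w)) + (norm (G u) + norm (G w))"
        using norm_triangle_ineq4 norm_triangle_ineq[of "G u" "G w"] by (smt (verit))
      then show ?thesis
        using Gsmall[OF uw] Gsmall[OF u(1) 2(1)] Gsmall[OF w(1) 2(2)] by linarith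
    qed
    ultimately have "G (u + w) - (G u + G w) = 0" by (intro e1(2))
    then show ?thesis by simp
  qed
  \<comment> \<open>Additivity is only local, so all partial multiples (\<open>k / N\<close>)
    \<open>w\<close> are kept in the ball of radius \<open>d\<close>. This ties \<open>G w\<close>
    to the values of \<open>G\<close> at arbitrarily short vectors.\<close>
  have Gscale: "G w = real N *\<^sub>R G ((1 / real N) *\<^sub>R w)"
    if w: "w \<in> Cn n" "norm w < d" and N: "N > 0" for w N
  proof -
    have nrm: "norm ((real k / real N) *\<^sub>R w) < d" if "k \<le> N" for k
    proof -
      have "norm ((real k / real N) *\<^sub>R w) \<le> 1 * norm w"
        unfolding norm_scaleR using that N by (intro mult_right_mono) auto
      then show ?thesis using w(2) by simp
    qed
    have "G ((real k / real N) *\<^sub>R w) = real k *\<^sub>R G ((1 / real N) *\<^sub>R w)" if "k \<le> N" for k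
      using that
    proof (induction k)
      case (Suc k)
      have "(real (Suc k) / real N) *\<^sub>R w = (real k / real N) *\<^sub>R w + (real 1 / real N) *\<^sub>R w"
        by (simp add: add_divide_distrib scaleR_left_distrib)
      also have "G \<dots> = G ((real k / real N) *\<^sub>R w) + G ((real 1 / real N) *\<^sub>R w)"
        using Suc.prems w(1) N by (intro Gadd nrm Cn_scaleR) auto
      finally show ?case using Suc by (simp add: scaleR_left_distrib)
    qed (simp add: G_def)
    from this[of N] show ?thesis using N by simp
  qed
  have GD: "Poly_Mapping.lookup (G w) j = D j w" if j: "j < p" and w: "w \<in> Cn n" "norm w < d" for j w
  proof -
    let ?a = "cmod (Poly_Mapping.lookup (G w) j - D j w)"
    have lin: "linear (D j)" using has_derivative_linear[OF D[OF j]] .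
    \<comment> \<open>The error of the linear approximation at \<open>w\<close> is \<open>N\<close>
      times the error at \<open>w / N\<close>, which for large \<open>N\<close> is at most
      \<open>e\<close> times the norm of \<open>w / N\<close>. The factors \<open>N\<close> cancel,
      and \<open>e\<close> was arbitrary.\<close>
    have le: "?a \<le> e * norm w" if "e > 0" for e
    proof -
      obtain d' where d': "d' > 0" "\<And>y. y \<in> Cn n \<Longrightarrow> norm y < d' \<Longrightarrow>
          cmod (Poly_Mapping.lookup (F y) j - Poly_Mapping.lookup (F 0) j - D j y) \<le> e * norm y"
        using D[OF j] \<open>e > 0\<close> unfolding has_derivative_within_alt by (metis diff_zero)
      obtain N where N: "norm w / d' < real N" using reals_Archimedean2 by blast
      have N0: "N > 0"
        using N d'(1) by (metis divide_nonneg_pos norm_ge_zero not_less of_nat_0 gr0I)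
      let ?y = "(1 / real N) *\<^sub>R w"
      have y: "?y \<in> Cn n" "norm ?y < d'"
        using w(1) N N0 d'(1) by (auto simp: Cn_scaleR field_simps)
      have "?a = real N * cmod (Poly_Mapping.lookup (G ?y) j - D j ?y)"
      proof -
        have "D j w = real N *\<^sub>R D j ?y" using linear_scale[OF lin] N0 by simp
        then have "Poly_Mapping.lookup (G w) j - D j w = real N *\<^sub>R (Poly_Mapping.lookup (G ?y) j - D j ?y)"
          by (subst Gscale[OF w N0]) (simp only: lookup_scaleR scaleR_diff_right)
        then show ?thesis by simp
      qed
      also have "\<dots> \<le> real N * (e * norm ?y)"
        using d'(2)[OF y] by (intro mult_left_mono) (auto simp: G_def lookup_minus)
      also have "\<dots> = e * norm w" using N0 by simp
      finally show ?thesis .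
    qed
    have "?a \<le> 0"
    proof (rule ccontr)
      assume a: "\<not> ?a \<le> 0"
      then have "norm w > 0" using le[of 1] by linarith
      then show False using le[of "?a / (2 * norm w)"] a by simp
    qed
    then show ?thesis by simp
  qed

  \<comment> \<open>The Jacobian matrix of \<open>F\<close> at 0, read off on the units.\<close>
  define L where "L = lin_of n (\<lambda>i. \<Sum>j<p. Poly_Mapping.single j (D j (Poly_Mapping.single i 1)))"
  have L: "clinear L" unfolding L_def by (rule clinear_lin_of)
  have LC: "L v \<in> Cn p" for v
    unfolding L_def by (intro lin_of_closed Cn_sum single_in_Cn) auto
  have Llookup: "Poly_Mapping.lookup (L v) j = D j v" if "j < p" "v \<in> Cn n" for j v
  proof -
    have lin: "linear (D j)" using has_derivative_linear[OF D[OF that(1)]] .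
    have "D j v = (\<Sum>i<n. D j (cscale (Poly_Mapping.lookup v i) (Poly_Mapping.single i 1)))"
      by (subst Cn_expand[OF that(2)]) (rule linear_sum[OF lin])
    also have "\<dots> = (\<Sum>i<n. Poly_Mapping.lookup v i * D j (Poly_Mapping.single i 1))"
      using Dc[OF that(1)] single_in_Cn by (intro sum.cong) auto
    also have "\<dots> = Poly_Mapping.lookup (L v) j"
      using that(1)
      by (simp add: L_def lin_of_def lookup_sum lookup_cscale lookup_single when_def if_distrib cong: if_cong)
    finally show ?thesis by simp
  qed
  have LG: "L w = G w" if "w \<in> Cn n" "norm w < d" for w
  proof (rule poly_mapping_eqI)
    fix j
    have "G w \<in> Cn p" using GC small that d by simp
    then show "Poly_Mapping.lookup (L w) j = Poly_Mapping.lookup (G w) j"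
      using Llookup[of j w] GD[of j w] that LC[of w] by (cases "j < p") (auto simp: Cn_iff)
  qed
  \<comment> \<open>Every \<open>v\<close> is an integer multiple of a vector in the ball where
    \<open>L\<close> agrees with \<open>G\<close>, and both sides respect sums.\<close>
  have \<phi>L: "\<phi> (cquot_proj X v) = cquot_proj Y (L v)" if v: "v \<in> Cn n" for v
  proof -
    obtain N where N: "norm v / d < real N" using reals_Archimedean2 by blast
    have N0: "N > 0"
      using N d by (metis divide_nonneg_pos norm_ge_zero not_less of_nat_0 gr0I)
    define w where "w = (1 / real N) *\<^sub>R v"
    have w: "w \<in> Cn n" "norm w < d"
      using v N N0 d by (auto simp: Cn_scaleR field_simps w_def)
    have "\<phi> (cquot_proj X (real k *\<^sub>R w)) = cquot_proj Y (real k *\<^sub>R L w)" for k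
    proof (induction k)
      case (Suc k)
      have "\<phi> (cquot_proj X (real k *\<^sub>R w + w)) = cquot_proj Y (real k *\<^sub>R L w + L w)"
        using \<phi>mult[OF Cn_scaleR[OF w(1)] w(1)] Suc \<phi>G small w d LG[OF w]
        by (simp add: mult_cquot_group[OF Y])
      then show ?case by (simp add: scaleR_left_distrib add.commute)
    qed (simp add: \<phi>0)
    from this[of N] show ?thesis
      using N0 clinear_scaleR[OF L] by (simp add: w_def)
  qed
  have "L \<gamma> \<in> periods Y" if "\<gamma> \<in> periods X" for \<gamma>
  proof -
    have "cquot_proj X \<gamma> = cquot_proj X 0" using that cquot_proj_eq_iff[OF X] by simp
    then have "cquot_proj Y (L \<gamma>) = cquot_proj Y 0"
      using \<phi>L[of \<gamma>] \<phi>0 that periods_subset[OF X] n_def by auto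
    then show ?thesis using cquot_proj_eq_iff[OF Y, of "L \<gamma>" 0] by simp
  qed
  then show ?thesis using L LC \<phi>L n_def p_def by blast
qed

text \<open>If \<open>x\<close> were outside \<open>W\<close>, distinct real numbers
  \<open>t\<close> would need distinct \<open>g\<close>, an injection of the reals into a countable
  set. An isogeny being onto says only that the image of its differential together with the periods
  exhausts the target; this removes the periods.\<close>

lemma subspace_plus_countable:
  assumes "subspace W" "countable G" "\<And>t :: real. \<exists>g\<in>G. t *\<^sub>R x - g \<in> W"
  shows "x \<in> W"
proof (rule ccontr)
  assume x: "x \<notin> W"
  obtain g where g: "\<And>t. g t \<in> G" "\<And>t. t *\<^sub>R x - g t \<in> W" using assms(3) by metis
  have "inj g"
  proof (rule injI)
    fix s t assume "g s = g t"
    then have "(s *\<^sub>R x - g s) - (t *\<^sub>R x - g s) \<in> W"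
      using g(2) subspace_diff[OF assms(1)] by metis
    then have st: "(s - t) *\<^sub>R x \<in> W" by (simp add: scaleR_left_diff_distrib)
    show "s = t"
    proof (rule ccontr)
      assume "s \<noteq> t"
      then have "x = (1 / (s - t)) *\<^sub>R ((s - t) *\<^sub>R x)" by simp
      then show False using x st subspace_scale[OF assms(1)] by metis
    qed
  qed
  moreover have "countable (range g)"
    using g(1) assms(2) by (meson countable_subset image_subsetI)
  ultimately have "countable (UNIV :: real set)"
    using countable_image_inj_on by blast
  then show False using uncountable_UNIV_real by blast
qed

lemma clinear_inverse:
  assumes "clinear L" "inj_on L (Cn n)" "L ` Cn n = Cn p"
  obtains T where "clinear T" "\<And>v. T v \<in> Cn n" "\<And>v. v \<in> Cn n \<Longrightarrow> T (L v) = v"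
    "\<And>w. w \<in> Cn p \<Longrightarrow> L (T w) = w"
proof
  define b where "b i = inv_into (Cn n) L (Poly_Mapping.single i 1)" for i :: nat
  have b: "b i \<in> Cn n" "L (b i) = Poly_Mapping.single i 1" if "i < p" for i
    using single_in_Cn[OF that] assms(3) unfolding b_def
    by (metis inv_into_into, metis f_inv_into_f)
  show "clinear (lin_of p b)" by (rule clinear_lin_of)
  show T: "lin_of p b v \<in> Cn n" for v using b by (intro lin_of_closed)
  show L: "L (lin_of p b w) = w" if "w \<in> Cn p" for w
  proof -
    have "L (lin_of p b w) = (\<Sum>i<p. cscale (Poly_Mapping.lookup w i) (Poly_Mapping.single i 1))"
      using b(2) by (simp add: lin_of_def cvec_pair.linear_sum[OF assms(1)] cvec_pair.linear_scale[OF assms(1)])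
    then show ?thesis using Cn_expand[OF that] by simp
  qed
  show "lin_of p b (L v) = v" if "v \<in> Cn n" for v
  proof (rule inj_onD[OF assms(2) _ T that])
    show "L (lin_of p b (L v)) = L v" using assms(3) that by (intro L) blast
  qed
qed

text \<open>Finiteness of the kernel gives \<open>M\<close> such that \<open>M\<close> times
  \<open>v\<close> is a period whenever \<open>L v\<close> is one. The same \<open>M\<close> does
  double duty: a nonzero kernel of \<open>L\<close> would put a real line into the periods, and
  \<open>M\<close> is a denominator for the inverse of \<open>L\<close>.\<close>

lemma isogeny_imp_invertible:
  assumes X: "is_cquot X" and Y: "is_cquot Y" and iso: "isogeny X Y \<phi>"
  shows "\<exists>L. qhom.invertible X Y L"
proof -
  let ?n = "cdim X" and ?p = "cdim Y"
  have "holomorphic_hom X Y \<phi>" using iso by (simp add: isogeny_def)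
  from holomorphic_hom_lift[OF X Y this]
  obtain L where L: "clinear L" and LC: "L ` Cn ?n \<subseteq> Cn ?p" and LP: "L ` periods X \<subseteq> periods Y"
    and \<phi>L: "\<And>v. v \<in> Cn ?n \<Longrightarrow> \<phi> (cquot_proj X v) = cquot_proj Y (L v)"
    by (elim exE conjE) (rule that, assumption+, drule(1) bspec, assumption)
  let ?A = "{v \<in> Cn ?n. L v \<in> periods Y}"
  let ?ker = "kernel (cquot_group X) (cquot_group Y) \<phi>"
  have "\<exists>M>0. \<forall>v\<in>?A. real M *\<^sub>R v \<in> periods X"
  proof (rule finite_cosets_imp_torsion)
    show "finite ?ker" using iso by (simp add: isogeny_def)
    show "cquot_proj X ` ?A \<subseteq> ?ker"
      using \<phi>L cquot_proj_eq_iff[OF Y, of _ 0] by (auto simp: kernel_def carrier_cquot_group one_cquot_group)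
    show "real k *\<^sub>R x \<in> ?A" if "x \<in> ?A" for x k
      using that add_subgroup_nat[OF add_subgroup_periods[OF Y]]
      by (auto simp: Cn_scaleR clinear_scaleR[OF L])
    show "add_subgroup (periods X)" by (rule add_subgroup_periods[OF X])
  qed (use cquot_proj_eq_iff[OF X] in auto)
  then obtain M where M: "M > 0" "\<And>v. v \<in> Cn ?n \<Longrightarrow> L v \<in> periods Y \<Longrightarrow> real M *\<^sub>R v \<in> periods X"
    by auto
  have "inj_on L (Cn ?n)"
  proof (subst linear_inj_on_iff_eq_0[OF clinear_imp_linear[OF L] subspace_Cn], intro ballI impI)
    fix v assume v: "v \<in> Cn ?n" "L v = 0"
    have "t *\<^sub>R (real M *\<^sub>R v) \<in> periods X" for t
    proof -
      have "L (t *\<^sub>R v) \<in> periods Y"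
        using v(2) add_subgroup_0[OF add_subgroup_periods[OF Y]] by (simp add: clinear_scaleR[OF L])
      then show ?thesis
        using M(2)[of "t *\<^sub>R v"] v(1) by (simp add: Cn_scaleR scaleR_left_commute mult.commute)
    qed
    then have "real M *\<^sub>R v = 0"
      by (rule real_multiples_in_discrete_subgroup[OF add_subgroup_periods[OF X] discrete_periods[OF X]])
    then show "v = 0" using M(1) by simp
  qed
  moreover have "L ` Cn ?n = Cn ?p"
  proof (intro equalityI LC subsetI)
    fix x assume x: "x \<in> Cn ?p"
    show "x \<in> L ` Cn ?n"
    proof (rule subspace_plus_countable)
      show "subspace (L ` Cn ?n)"
        using linear_subspace_image[OF clinear_imp_linear[OF L] subspace_Cn] .
      show "countable (periods Y)"
        using Y countable_discrete_subgroup is_cquot_iff by blast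
      fix t
      have "cquot_proj Y (t *\<^sub>R x) \<in> \<phi> ` carrier (cquot_group X)"
        using iso Cn_scaleR[OF x] by (auto simp: isogeny_def carrier_cquot_group)
      then obtain v where v: "v \<in> Cn ?n" "cquot_proj Y (t *\<^sub>R x) = cquot_proj Y (L v)"
        using \<phi>L by (auto simp: carrier_cquot_group)
      then have "t *\<^sub>R x - L v \<in> periods Y" using cquot_proj_eq_iff[OF Y] by blast
      moreover have "t *\<^sub>R x - (t *\<^sub>R x - L v) \<in> L ` Cn ?n" using v(1) by simp
      ultimately show "\<exists>g\<in>periods Y. t *\<^sub>R x - g \<in> L ` Cn ?n" by blast
    qed
  qed
  ultimately obtain T where T: "clinear T" "\<And>v. T v \<in> Cn ?n" "\<And>v. v \<in> Cn ?n \<Longrightarrow> T (L v) = v"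
    "\<And>w. w \<in> Cn ?p \<Longrightarrow> L (T w) = w"
    using clinear_inverse[OF L] by metis
  have "qhom X Y L"
    using X Y L LC LP by (auto simp: qhom_def intro!: exI[of _ 1])
  moreover have "qhom Y X T"
  proof -
    have "L (T \<gamma>) \<in> periods Y" if "\<gamma> \<in> periods Y" for \<gamma>
      using that T(4) periods_subset[OF Y] by auto
    then have "\<forall>\<gamma>\<in>periods Y. real M *\<^sub>R T \<gamma> \<in> periods X"
      using M(2) T(2) by blast
    then show ?thesis using M(1) X Y T(1,2) by (auto simp: qhom_def)
  qed
  ultimately show ?thesis
    unfolding qhom.invertible_def qhom.inverse_pair_def using T(3,4) by blast
qed

section \<open>Products\<close>

definition embed :: "nat \<Rightarrow> nat \<Rightarrow> cvec \<Rightarrow> cvec" where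
  "embed s d v = (\<Sum>j<d. Poly_Mapping.single (s + j) (Poly_Mapping.lookup v j))"

lemma lookup_embed:
  "Poly_Mapping.lookup (embed s d v) t = (if s \<le> t \<and> t < s + d then Poly_Mapping.lookup v (t - s) else 0)"
proof -
  have "Poly_Mapping.lookup (embed s d v) t =
      (\<Sum>j<d. if j = t - s \<and> s \<le> t then Poly_Mapping.lookup v j else 0)"
    unfolding embed_def lookup_sum lookup_single when_def by (intro sum.cong) auto
  also have "\<dots> = (if s \<le> t \<and> t < s + d then Poly_Mapping.lookup v (t - s) else 0)"
    by (cases "s \<le> t") (auto simp: less_diff_conv2)
  finally show ?thesis .
qed

lemma clinear_block: "clinear (block s d)"
  by (auto simp: clinear_iff lookup_block lookup_add lookup_cscale intro!: poly_mapping_eqI)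

lemma clinear_embed: "clinear (embed s d)"
  by (auto simp: clinear_iff lookup_embed lookup_add lookup_cscale intro!: poly_mapping_eqI)

lemma block_in_Cn: "block s d v \<in> Cn d"
  by (simp add: Cn_iff lookup_block)

context
  fixes k :: nat and X :: "nat \<Rightarrow> cquot"
begin

definition offset :: "nat \<Rightarrow> nat" where
  "offset i = (\<Sum>j<i. cdim (X j))"

definition prod_proj :: "nat \<Rightarrow> cvec \<Rightarrow> cvec" where
  "prod_proj i = block (offset i) (cdim (X i))"

definition prod_inj :: "nat \<Rightarrow> cvec \<Rightarrow> cvec" where
  "prod_inj i = embed (offset i) (cdim (X i))"

lemma offset_Suc: "offset (Suc i) = offset i + cdim (X i)"
  by (simp add: offset_def)

lemma offset_mono: "i \<le> j \<Longrightarrow> offset i \<le> offset j"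
  unfolding offset_def by (intro sum_mono2) auto

lemma offset_add_le: "i < j \<Longrightarrow> offset i + cdim (X i) \<le> offset j"
  using offset_mono[of "Suc i" j] by (simp add: offset_Suc)

lemma cdim_prod: "cdim (cquot_prod k X) = offset k"
  by (simp add: cquot_prod_def offset_def)

lemma periods_prod:
  "periods (cquot_prod k X) = {v \<in> Cn (offset k). \<forall>i<k. prod_proj i v \<in> periods (X i)}"
  by (simp add: cquot_prod_def offset_def prod_proj_def)

lemma prod_proj_inj:
  assumes "v \<in> Cn (cdim (X i))"
  shows "prod_proj j (prod_inj i v) = (if i = j then v else 0)"
proof (rule poly_mapping_eqI)
  fix t
  show "Poly_Mapping.lookup (prod_proj j (prod_inj i v)) t = Poly_Mapping.lookup (if i = j then v else 0) t"
    using assms offset_add_le[of i j] offset_add_le[of j i]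
    by (cases i j rule: linorder_cases)
       (auto simp: prod_proj_def prod_inj_def lookup_block lookup_embed Cn_iff)
qed

lemma sum_prod_inj_proj:
  assumes "v \<in> Cn (offset k)"
  shows "(\<Sum>i<k. prod_inj i (prod_proj i v)) = v"
proof -
  have "Poly_Mapping.lookup (\<Sum>i<m. prod_inj i (prod_proj i v)) t =
      (if t < offset m then Poly_Mapping.lookup v t else 0)" for m t
  proof (induction m)
    case (Suc m)
    then show ?case
      by (auto simp: lookup_add offset_Suc prod_inj_def prod_proj_def lookup_block lookup_embed)
  qed (simp add: offset_def)
  then show ?thesis
    using assms by (intro poly_mapping_eqI) (auto simp: Cn_iff)
qed

lemma prod_inj_in_Cn:
  assumes "i < k"
  shows "prod_inj i v \<in> Cn (offset k)"
  using offset_add_le[OF assms] by (auto simp: Cn_iff prod_inj_def lookup_embed)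

lemma is_cquot_prod:
  assumes "\<And>i. i < k \<Longrightarrow> is_cquot (X i)"
  shows "is_cquot (cquot_prod k X)"
proof -
  let ?P = "periods (cquot_prod k X)"
  have lin: "clinear (prod_proj i)" for i
    by (simp add: prod_proj_def clinear_block)
  have P: "add_subgroup ?P"
    unfolding add_subgroup_def
    using add_subgroup_periods[OF assms]
    by (auto simp: periods_prod Cn_diff cvec_pair.linear_0[OF lin] cvec_pair.linear_diff[OF lin]
        intro: add_subgroup_0 add_subgroup_diff)
  \<comment> \<open>The condition on \<open>i\<close> stands behind the radius so that one choice
    function provides radii for all factors.\<close>
  have "\<forall>i. \<exists>e>0. i < k \<longrightarrow> (\<forall>x\<in>?P. norm x < e \<longrightarrow> prod_proj i x = 0)"
  proof
    fix i
    show "\<exists>e>0. i < k \<longrightarrow> (\<forall>x\<in>?P. norm x < e \<longrightarrow> prod_proj i x = 0)"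
    proof (cases "i < k")
      case True
      obtain e where e: "e > 0" "\<And>x. x \<in> periods (X i) \<Longrightarrow> norm x < e \<Longrightarrow> x = 0"
        using assms[OF True] is_cquot_iff discrete_subgroup_iff by metis
      obtain K where K: "K > 0" "\<And>v. v \<in> Cn (offset k) \<Longrightarrow> norm (prod_proj i v) \<le> K * norm v"
        using clinear_bound_Cn[OF lin] by metis
      have "prod_proj i x = 0" if x: "x \<in> ?P" "norm x < e / K" for x
      proof (rule e(2))
        show "prod_proj i x \<in> periods (X i)" using x(1) True by (simp add: periods_prod)
        have "K * norm x < e" using x(2) K(1) by (simp add: field_simps)
        then show "norm (prod_proj i x) < e"
          using K(2)[of x] x(1) by (simp add: periods_prod)
      qed
      then show ?thesis using e(1) K(1) by (intro exI[of _ "e / K"]) simp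
    qed (auto intro: zero_less_one)
  qed
  then obtain e where e: "\<And>i. e i > 0"
    "\<And>i x. i < k \<Longrightarrow> x \<in> ?P \<Longrightarrow> norm x < e i \<Longrightarrow> prod_proj i x = 0"
    by metis
  \<comment> \<open>The entry 1 keeps the minimum defined when \<open>k\<close> is 0.\<close>
  let ?e = "Min (insert 1 (e ` {..<k}))"
  have "?e > 0" using e(1) by auto
  moreover have "x = 0" if x: "x \<in> ?P" "norm x < ?e" for x
  proof -
    have "prod_proj i x = 0" if "i < k" for i
      using that x by (intro e(2)) auto
    moreover have "prod_inj i 0 = 0" for i
      using cvec_pair.linear_0[OF clinear_embed] by (simp add: prod_inj_def)
    ultimately have "(\<Sum>i<k. prod_inj i (prod_proj i x)) = 0" by simp
    then show ?thesis using sum_prod_inj_proj[of x] x(1) by (simp add: periods_prod)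
  qed
  ultimately have "discrete ?P" using discrete_subgroup_iff[OF P] by blast
  then show ?thesis using P by (auto simp: is_cquot_iff periods_prod cdim_prod)
qed

lemma qhom_prod_proj:
  assumes "\<And>i. i < k \<Longrightarrow> is_cquot (X i)" "i < k"
  shows "qhom (cquot_prod k X) (X i) (prod_proj i)"
  using is_cquot_prod assms
  by (auto simp: qhom_def prod_proj_def clinear_block block_in_Cn cdim_prod periods_prod intro!: exI[of _ 1])

lemma qhom_prod_inj:
  assumes "\<And>i. i < k \<Longrightarrow> is_cquot (X i)" "i < k"
  shows "qhom (X i) (cquot_prod k X) (prod_inj i)"
proof -
  have "prod_inj i \<gamma> \<in> periods (cquot_prod k X)" if "\<gamma> \<in> periods (X i)" for \<gamma>
  proof -
    have "\<gamma> \<in> Cn (cdim (X i))" using that periods_subset[OF assms(1)[OF assms(2)]] by blast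
    then show ?thesis
      using that add_subgroup_0[OF add_subgroup_periods[OF assms(1)]]
      by (auto simp: periods_prod prod_inj_in_Cn[OF assms(2)] prod_proj_inj)
  qed
  then show ?thesis
    using is_cquot_prod[OF assms(1)] assms prod_inj_in_Cn[OF assms(2)]
    by (auto simp: qhom_def cdim_prod prod_inj_def clinear_embed intro!: exI[of _ 1])
qed

end

section \<open>Geometrically simple toroidal groups\<close>

interpretation cfun: vector_space_pair cscale "(*) :: complex \<Rightarrow> complex \<Rightarrow> complex"
  by unfold_locales (auto simp: algebra_simps)

text \<open>A \<open>cquot\<close> lives over a standard number space, so the image of an idempotent
  has to be put into coordinates with respect to a complex basis before it can carry a
  quotient.\<close>

lemma csubspace_basis_map:
  assumes "cvec.subspace W" "W \<subseteq> Cn n"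
  obtains d q where "clinear q" "q ` Cn d = W" "inj_on q (Cn d)"
proof -
  obtain B where B: "B \<subseteq> W" "cvec.independent B" "W \<subseteq> cvec.span B"
    using cvec.basis_exists by metis
  have "B \<subseteq> cvec.span ((\<lambda>i. Poly_Mapping.single i 1) ` {..<n})"
  proof
    fix v assume "v \<in> B"
    then have v: "v \<in> Cn n" using B(1) assms(2) by blast
    show "v \<in> cvec.span ((\<lambda>i. Poly_Mapping.single i 1) ` {..<n})"
      by (subst Cn_expand[OF v]) (intro cvec.span_sum cvec.span_scale cvec.span_base imageI)
  qed
  then have "finite B"
    using cvec.independent_span_bound[OF _ B(2)] by blast
  then obtain b where b: "bij_betw b {0..<card B} B"
    using ex_bij_betw_nat_finite by blast
  define d where "d = card B"
  have b: "bij_betw b {..<d} B" using b by (simp add: d_def atLeast0LessThan)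
  show ?thesis
  proof
    let ?q = "lin_of d b"
    show q: "clinear ?q" by (rule clinear_lin_of)
    have qB: "?q v = (\<Sum>x\<in>B. cscale (Poly_Mapping.lookup v (inv_into {..<d} b x)) x)" for v
    proof -
      have "?q v = (\<Sum>i<d. cscale (Poly_Mapping.lookup v (inv_into {..<d} b (b i))) (b i))"
        unfolding lin_of_def using b
        by (intro sum.cong refl) (auto simp: bij_betw_def inv_into_f_f)
      then show ?thesis using sum.reindex_bij_betw[OF b] by simp
    qed
    show "?q ` Cn d = W"
    proof (intro equalityI subsetI)
      fix w assume "w \<in> ?q ` Cn d"
      then show "w \<in> W"
        using B(1) by (auto simp: qB intro!: cvec.subspace_sum[OF assms(1)] cvec.subspace_scale[OF assms(1)])
    next
      fix w assume "w \<in> W"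
      then obtain u where u: "w = (\<Sum>x\<in>B. cscale (u x) x)"
        using B(3) cvec.span_finite[OF \<open>finite B\<close>] by auto
      let ?v = "\<Sum>i<d. Poly_Mapping.single i (u (b i))"
      have "Poly_Mapping.lookup ?v i = u (b i)" if "i < d" for i
        using that by (simp add: lookup_sum lookup_single when_def)
      then have "?q ?v = (\<Sum>i<d. cscale (u (b i)) (b i))"
        by (simp add: lin_of_def)
      also have "\<dots> = w" using sum.reindex_bij_betw[OF b, of "\<lambda>x. cscale (u x) x"] u by simp
      finally show "w \<in> ?q ` Cn d"
        using Cn_sum[of "{..<d}" "\<lambda>i. Poly_Mapping.single i (u (b i))" d] single_in_Cn by (metis imageI lessThan_iff)
    qed
    show "inj_on ?q (Cn d)"
    proof (subst linear_inj_on_iff_eq_0[OF clinear_imp_linear[OF q] subspace_Cn], intro ballI impI)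
      fix v assume v: "v \<in> Cn d" "?q v = 0"
      then have zero: "\<forall>x\<in>B. Poly_Mapping.lookup v (inv_into {..<d} b x) = 0"
        using B(2) cvec.dependent_finite[OF \<open>finite B\<close>] qB[of v] by metis
      show "v = 0"
      proof (rule poly_mapping_eqI)
        fix i
        show "Poly_Mapping.lookup v i = Poly_Mapping.lookup 0 i"
        proof (cases "i < d")
          case True
          then have "b i \<in> B" "inv_into {..<d} b (b i) = i" using b by (auto simp: bij_betw_def inv_into_f_f)
          then show ?thesis using zero by force
        qed (use v(1) in \<open>simp add: Cn_iff\<close>)
      qed
    qed
  qed
qed

text \<open>\<open>Z\<close> is the image of \<open>e\<close> in coordinates, and its periods are
  all periods of \<open>X\<close> that lie in this image. This choice makes \<open>q\<close>
  injective on the quotients; \<open>p\<close> is then rational with the same denominator as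
  \<open>e\<close>. A bounded map with a left inverse pulls a discrete group back to a discrete
  one.\<close>

lemma split_idempotent:
  assumes e: "qhom X X e" and idem: "\<forall>v\<in>Cn (cdim X). e (e v) = e v"
  shows "\<exists>Z p q. qhom X Z p \<and> qhom Z X q \<and> (\<forall>w\<in>Cn (cdim Z). p (q w) = w) \<and>
    (\<forall>v\<in>Cn (cdim X). q (p v) = e v) \<and> periods Z = {w \<in> Cn (cdim Z). q w \<in> periods X}"
proof -
  let ?n = "cdim X"
  have X: "is_cquot X" and e': "clinear e" and eC: "e ` Cn ?n \<subseteq> Cn ?n"
    using e by (auto simp: qhom_def)
  obtain N where N: "N > 0" "\<And>\<gamma>. \<gamma> \<in> periods X \<Longrightarrow> real N *\<^sub>R e \<gamma> \<in> periods X"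
    using e unfolding qhom_def by metis
  have "cvec.subspace (e ` Cn ?n)"
    by (rule cvec_pair.linear_subspace_image[OF e' csubspace_Cn])
  then obtain d q where q: "clinear q" "q ` Cn d = e ` Cn ?n" "inj_on q (Cn d)"
    using csubspace_basis_map[OF _ eC] by metis
  have qC: "q w \<in> Cn ?n" if "w \<in> Cn d" for w
    using q(2) eC that by (metis imageI subsetD)
  define c where "c i = inv_into (Cn d) q (e (Poly_Mapping.single i 1))" for i :: nat
  have c: "c i \<in> Cn d" "q (c i) = e (Poly_Mapping.single i 1)" if "i < ?n" for i
  proof -
    have "e (Poly_Mapping.single i 1) \<in> q ` Cn d"
      unfolding q(2) using single_in_Cn[OF that] by (rule imageI)
    then show "c i \<in> Cn d" "q (c i) = e (Poly_Mapping.single i 1)"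
      unfolding c_def by (rule inv_into_into, rule f_inv_into_f)
  qed
  define p where "p = lin_of ?n c"
  have p: "clinear p" unfolding p_def by (rule clinear_lin_of)
  have pC: "p v \<in> Cn d" for v unfolding p_def using c(1) by (intro lin_of_closed)
  have qp: "q (p v) = e v" if "v \<in> Cn ?n" for v
    using c(2) clinear_eq_lin_of[OF e' that]
    by (simp add: p_def lin_of_def cvec_pair.linear_sum[OF q(1)] cvec_pair.linear_scale[OF q(1)])
  have pq: "p (q w) = w" if "w \<in> Cn d" for w
  proof (rule inj_onD[OF q(3) _ pC that])
    have "q w \<in> e ` Cn ?n" using that q(2) by (metis imageI)
    then obtain v where "v \<in> Cn ?n" "q w = e v" by blast
    then show "q (p (q w)) = q w" using qp[OF qC[OF that]] idem by simp
  qed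
  define Z where "Z = \<lparr>cdim = d, periods = {w \<in> Cn d. q w \<in> periods X}\<rparr>"
  have Z: "cdim Z = d" "periods Z = {w \<in> Cn d. q w \<in> periods X}" by (simp_all add: Z_def)
  note G = add_subgroup_periods[OF X]
  have sub: "add_subgroup (periods Z)"
    unfolding add_subgroup_def
    by (auto simp: Z cvec_pair.linear_0[OF q(1)] cvec_pair.linear_diff[OF q(1)] Cn_diff
        add_subgroup_0[OF G] add_subgroup_diff[OF G])
  have "discrete (periods Z)"
  proof -
    obtain r where r: "r > 0" "\<And>x. x \<in> periods X \<Longrightarrow> norm x < r \<Longrightarrow> x = 0"
      using discrete_periods[OF X] discrete_subgroup_iff[OF G] by metis
    obtain K where K: "K > 0" "\<And>v. v \<in> Cn d \<Longrightarrow> norm (q v) \<le> K * norm v"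
      using clinear_bound_Cn[OF q(1)] by metis
    have "x = 0" if x: "x \<in> periods Z" "norm x < r / K" for x
    proof -
      have xd: "x \<in> Cn d" "q x \<in> periods X" using x(1) by (auto simp: Z)
      have "K * norm x < r" using x(2) K(1) by (simp add: field_simps)
      then have "norm (q x) < r" using K(2)[OF xd(1)] by simp
      then have "q x = 0" using r(2) xd(2) by blast
      then show ?thesis using pq[OF xd(1)] cvec_pair.linear_0[OF p] by simp
    qed
    moreover have "r / K > 0" using r(1) K(1) by simp
    ultimately show ?thesis using discrete_subgroup_iff[OF sub] by blast
  qed
  then have Zc: "is_cquot Z" using sub by (auto simp: is_cquot_iff Z)
  have "qhom Z X q"
    using X Zc q(1) qC by (auto simp: qhom_def Z intro!: exI[of _ 1])
  moreover have "qhom X Z p"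
  proof -
    have "real N *\<^sub>R p \<gamma> \<in> periods Z" if "\<gamma> \<in> periods X" for \<gamma>
    proof -
      have "\<gamma> \<in> Cn ?n" using that periods_subset[OF X] by blast
      then show ?thesis
        using N(2)[OF that] qp by (simp add: Z Cn_scaleR pC clinear_scaleR[OF q(1)])
    qed
    then show ?thesis using X Zc p pC N(1) by (auto simp: qhom_def Z)
  qed
  ultimately show ?thesis
    by (intro exI[of _ Z] exI[of _ p] exI[of _ q]) (simp add: pq qp Z)
qed

section \<open>Functionals, constant functions and the rank\<close>

lemma clinear_functional_separating:
  assumes "v \<notin> cvec.span S"
  obtains g where "Vector_Spaces.linear cscale (*) g" "g v = 1" "\<And>x. x \<in> S \<Longrightarrow> g x = 0"
proof -
  obtain B where B: "B \<subseteq> S" "cvec.independent B" "S \<subseteq> cvec.span B"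
    by (rule cvec.maximal_independent_subset)
  have "cvec.span B \<subseteq> cvec.span S" using B(1) by (rule cvec.span_mono)
  then have vB: "v \<notin> cvec.span B" using assms by blast
  then have "cvec.independent (insert v B)"
    using B(2) by (rule cvec.independent_insertI)
  then obtain g where g: "Vector_Spaces.linear cscale (*) g"
    "\<forall>x\<in>insert v B. g x = (if x = v then 1 else 0)"
    using cfun.linear_independent_extend[of "insert v B" "\<lambda>x. if x = v then 1 else 0"] by blast
  show ?thesis
  proof
    show "Vector_Spaces.linear cscale (*) g" by (rule g(1))
    show "g v = 1" using g(2) by simp
    fix x assume "x \<in> S"
    then have "x \<in> cvec.span B" using B(3) by blast
    moreover have "g x = 0" if "x \<in> B" for x
      using that g(2) vB cvec.span_base by auto
    ultimately show "g x = 0" by (rule cfun.linear_eq_0_on_span[OF g(1), rotated])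
  qed
qed

lemma independent_units: "cvec.independent ((\<lambda>i. Poly_Mapping.single i 1) ` {..<d})"
proof (rule cvec.independent_if_scalars_zero)
  fix f x assume sum: "(\<Sum>x\<in>(\<lambda>i. Poly_Mapping.single i 1) ` {..<d}. cscale (f x) x) = 0"
    and x: "x \<in> (\<lambda>i. Poly_Mapping.single i (1 :: complex)) ` {..<d}"
  have "inj_on (\<lambda>i. Poly_Mapping.single i (1 :: complex)) {..<d}"
    by (rule inj_onI) (metis lookup_single_eq lookup_single_not_eq zero_neq_one)
  then have 0: "(\<Sum>i<d. cscale (f (Poly_Mapping.single i 1)) (Poly_Mapping.single i 1)) = 0"
    using sum by (simp add: sum.reindex)
  obtain k where k: "k < d" "x = Poly_Mapping.single k 1" using x by auto
  have "f x = Poly_Mapping.lookup (\<Sum>i<d. cscale (f (Poly_Mapping.single i 1)) (Poly_Mapping.single i 1)) k"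
    using k by (simp add: lookup_sum lookup_cscale lookup_single when_def if_distrib cong: if_cong)
  then show "f x = 0" using 0 by simp
qed simp

text \<open>If \<open>B\<close> does not span over the complex numbers, \<open>g\<close> can
  annihilate \<open>B\<close> and be 1 at some vector outside its span. If it does, its size makes
  it a complex basis, and a dual coordinate takes only the values 0 and 1 on it.\<close>

lemma integral_functional:
  assumes "d \<ge> 1" "finite B" "card B \<le> d" "B \<subseteq> Cn d"
  obtains g v where "Vector_Spaces.linear cscale (*) g" "v \<in> Cn d" "g v = (1 :: complex)" "\<And>x. x \<in> B \<Longrightarrow> g x \<in> \<int>"
proof -
  let ?E = "(\<lambda>i. Poly_Mapping.single i (1 :: complex)) ` {..<d}"
  have cardE: "card ?E = d"
  proof -
    have "inj_on (\<lambda>i. Poly_Mapping.single i (1 :: complex)) {..<d}"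
      by (rule inj_onI) (metis lookup_single_eq lookup_single_not_eq zero_neq_one)
    then show ?thesis by (simp add: card_image)
  qed
  \<comment> \<open>Common form of both cases: \<open>S\<close> is \<open>B\<close> itself, or
    \<open>B\<close> without the basis vector \<open>v\<close>.\<close>
  have "\<exists>v\<in>Cn d. \<exists>S. v \<notin> cvec.span S \<and> B \<subseteq> insert v S"
  proof (cases "Cn d \<subseteq> cvec.span B")
    case False
    then show ?thesis by blast
  next
    case True
    have E: "?E \<subseteq> Cn d" using single_in_Cn by auto
    have "B \<noteq> {}"
    proof
      assume "B = {}"
      then have "Poly_Mapping.single 0 1 \<in> {0 :: cvec}"
        using True single_in_Cn[of 0 d 1] assms(1) by auto
      then show False by (metis lookup_single_eq lookup_zero singletonD zero_neq_one)
    qed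
    then obtain b where b: "b \<in> B" by blast
    have "b \<notin> cvec.span (B - {b})"
    proof
      assume "b \<in> cvec.span (B - {b})"
      then have "cvec.span (insert b (B - {b})) = cvec.span (B - {b})" by (rule cvec.span_redundant)
      moreover have "insert b (B - {b}) = B" using b by blast
      ultimately have "?E \<subseteq> cvec.span (B - {b})" using E True by auto
      then have "card ?E \<le> card (B - {b})"
        using cvec.independent_span_bound[OF _ independent_units] assms(2) by blast
      also have "\<dots> < card B" using b assms(2) by (intro psubset_card_mono) auto
      finally show False using cardE assms(3) by simp
    qed
    then show ?thesis using b assms(4) by blast
  qed
  then obtain v S where v: "v \<in> Cn d" "v \<notin> cvec.span S" "B \<subseteq> insert v S" by blast
  obtain g where g: "Vector_Spaces.linear cscale (*) g" "g v = 1" "\<And>x. x \<in> S \<Longrightarrow> g x = 0"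
    using clinear_functional_separating[OF v(2)] by metis
  show ?thesis
  proof (rule that[OF g(1) v(1) g(2)])
    fix x assume "x \<in> B"
    then show "g x \<in> \<int>" using v(3) g(2,3) by (cases "x = v") auto
  qed
qed

lemma lin_of_cscale: "lin_of n b (cscale c v) = cscale c (lin_of n b v)"
  by (rule cvec_pair.linear_scale[OF clinear_lin_of])

text \<open>The multiple \<open>P\<close> of \<open>p\<close> maps periods to periods and still
  covers \<open>Z\<close>, so \<open>f\<close> pulls back to a holomorphic function on
  \<open>X\<close>, which is constant.\<close>

lemma toroidal_quotient:
  assumes X: "toroidal X" and p: "qhom X Z p" and surj: "p ` Cn (cdim X) = Cn (cdim Z)"
    and f: "holomorphic_fun Z f"
  shows "\<exists>c. \<forall>x\<in>carrier (cquot_group Z). f x = c"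
proof -
  let ?n = "cdim X" and ?d = "cdim Z"
  have Xc: "is_cquot X" and Zc: "is_cquot Z" and lin: "clinear p"
    using p by (auto simp: qhom_def)
  obtain N where N: "N > 0" "\<And>\<gamma>. \<gamma> \<in> periods X \<Longrightarrow> real N *\<^sub>R p \<gamma> \<in> periods Z"
    using p unfolding qhom_def by metis
  define P where "P v = real N *\<^sub>R p v" for v
  have P: "clinear P" unfolding P_def by (rule clinear_scaleR_left[OF lin])
  have PC: "P v \<in> Cn ?d" if "v \<in> Cn ?n" for v
    unfolding P_def using surj that by (intro Cn_scaleR) blast
  have ind: "induced_map Z P (cquot_proj X v) = cquot_proj Z (P v)" for v
    by (rule induced_map_proj[OF Xc Zc P]) (use N(2) in \<open>auto simp: P_def\<close>)
  let ?P' = "lin_of ?n (\<lambda>i. P (Poly_Mapping.single i 1))"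
  have "holomorphic_fun X (\<lambda>x. f (induced_map Z P x))"
    unfolding holomorphic_fun_def holomorphic_Cn_def ind
  proof
    fix z assume z: "z \<in> Cn ?n"
    obtain f' where f': "((\<lambda>w. f (cquot_proj Z w)) has_derivative f') (at (P z) within Cn ?d)"
      "\<And>c v. v \<in> Cn ?d \<Longrightarrow> f' (cscale c v) = c * f' v"
      using f PC[OF z] unfolding holomorphic_fun_def holomorphic_Cn_def by metis
    have "((\<lambda>w. f (cquot_proj Z w)) has_derivative f') (at (P z) within P ` Cn ?n)"
      using f'(1) PC by (intro has_derivative_subset[OF f'(1)]) auto
    then have "((\<lambda>v. f (cquot_proj Z (P v))) has_derivative (\<lambda>v. f' (?P' v))) (at z within Cn ?n)"
      by (rule has_derivative_in_compose[OF has_derivative_clinear[OF P z]])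
    moreover have "f' (?P' (cscale c v)) = c * f' (?P' v)" if "v \<in> Cn ?n" for c v
    proof -
      have "?P' v \<in> Cn ?d" using PC single_in_Cn by (intro lin_of_closed) auto
      then show ?thesis using f'(2) by (simp add: lin_of_cscale)
    qed
    ultimately show "\<exists>g'. ((\<lambda>v. f (cquot_proj Z (P v))) has_derivative g') (at z within Cn ?n) \<and>
        (\<forall>c. \<forall>v\<in>Cn ?n. g' (cscale c v) = c * g' v)" by blast
  qed
  then obtain c where c: "\<And>x. x \<in> carrier (cquot_group X) \<Longrightarrow> f (induced_map Z P x) = c"
    using X unfolding toroidal_def by metis
  have "f x = c" if "x \<in> carrier (cquot_group Z)" for x
  proof -
    obtain w where w: "w \<in> Cn ?d" "x = cquot_proj Z w"
      using \<open>x \<in> carrier (cquot_group Z)\<close> by (auto simp: carrier_cquot_group)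
    have "w \<in> p ` Cn ?n" using w(1) surj by simp
    then obtain v where v: "v \<in> Cn ?n" "w = p v" by blast
    have "P ((1 / real N) *\<^sub>R v) = w" using N(1) v(2) by (simp add: P_def clinear_scaleR[OF lin])
    then have "induced_map Z P (cquot_proj X ((1 / real N) *\<^sub>R v)) = x" using ind w(2) by simp
    moreover have "cquot_proj X ((1 / real N) *\<^sub>R v) \<in> carrier (cquot_group X)"
      using Cn_scaleR[OF v(1)] by (auto simp: carrier_cquot_group)
    ultimately show ?thesis using c by metis
  qed
  then show ?thesis by blast
qed

text \<open>
  If the rank were at most the dimension \<open>d\<close>, then \<open>exp (2 \<pi> i M g)\<close>, with \<open>g\<close> a nonzero linear functional
  integral on a real basis of the span of the periods, would be a nonconstant function.
\<close>

lemma rank_of_constant_functions: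
  assumes Z: "is_cquot Z" and d: "cdim Z \<ge> 1"
    and const: "\<And>f. holomorphic_fun Z f \<Longrightarrow> \<exists>c. \<forall>x\<in>carrier (cquot_group Z). f x = c"
  shows "\<exists>m. 1 \<le> m \<and> m \<le> cdim Z \<and> dim (periods Z) = cdim Z + m"
proof -
  let ?d = "cdim Z"
  note G = add_subgroup_periods[OF Z] and sub = periods_subset[OF Z] and disc = discrete_periods[OF Z]
  obtain E where E: "finite E" "card E \<le> 2 * ?d" "Cn ?d \<subseteq> span E"
    using Cn_real_span by metis
  have up: "dim (periods Z) \<le> 2 * ?d"
    using order_trans[OF dim_le_card[OF order_trans[OF sub E(3)] E(1)] E(2)] .
  have "\<not> dim (periods Z) \<le> ?d"
  proof
    assume le: "dim (periods Z) \<le> ?d"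
    obtain B where B: "B \<subseteq> periods Z" "independent B" "periods Z \<subseteq> span B" "card B = dim (periods Z)"
      by (rule basis_exists)
    have "finite B"
      using independent_span_bound[OF E(1) B(2)] B(1) sub E(3) by blast
    then obtain g v where g: "Vector_Spaces.linear cscale (*) g" and v: "v \<in> Cn ?d" "g v = 1"
      and gB: "\<And>x. x \<in> B \<Longrightarrow> g x \<in> \<int>"
      using integral_functional[OF d, of B] le B(1,4) sub by (metis subset_trans)
    have gR: "g (t *\<^sub>R x) = of_real t * g x" for t x
      using cfun.linear_scale[OF g, of "of_real t" x] by (simp add: cscale_of_real)
    \<comment> \<open>The functional is known to be integral only on the basis \<open>B\<close>.
      Since \<open>G1\<close> contains \<open>B\<close>, it has the same real span as the periods,
      and torsion supplies \<open>M\<close>.\<close>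
    define G1 where "G1 = {x \<in> periods Z. g x \<in> \<int>}"
    have G1: "add_subgroup G1"
      unfolding add_subgroup_def G1_def
      by (auto simp: add_subgroup_0[OF G] add_subgroup_diff[OF G] cfun.linear_0[OF g] cfun.linear_diff[OF g])
    have "B \<subseteq> G1" using B(1) gB by (auto simp: G1_def)
    then have "span B \<subseteq> span G1" by (rule span_mono)
    then have sp: "periods Z \<subseteq> span G1" using B(3) by simp
    have "G1 \<subseteq> periods Z" by (auto simp: G1_def)
    from torsion_of_span[OF G1 G disc sub this sp]
    obtain M where M: "M > 0" "\<And>x. x \<in> periods Z \<Longrightarrow> g (real M *\<^sub>R x) \<in> \<int>"
      by (auto simp: G1_def)
    define c where "c = 2 * of_real pi * \<i> * of_nat M"
    have per: "exp (c * g z) = exp (c * g w)" if zw: "z - w \<in> periods Z" for z w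
    proof -
      obtain k :: int where k: "of_nat M * g (z - w) = of_int k"
        using M(2)[OF zw] by (auto simp: gR elim: Ints_cases)
      have "c * g z = c * g w + of_real (2 * of_int k * pi) * \<i>"
      proof -
        have "c * g z = c * g w + 2 * of_real pi * \<i> * (of_nat M * g (z - w))"
          by (simp add: c_def cfun.linear_diff[OF g] algebra_simps)
        then show ?thesis unfolding k by (simp add: algebra_simps)
      qed
      moreover have "exp (of_real (2 * of_int k * pi) * \<i>) = 1"
        by (rule exp_integer_2pi) simp
      ultimately show ?thesis by (simp add: exp_add)
    qed
    define f where "f K = exp (c * g (SOME z. z \<in> K))" for K
    have f: "f (cquot_proj Z z) = exp (c * g z)" for z
    proof -
      have "(SOME w. w \<in> cquot_proj Z z) \<in> cquot_proj Z z"
        using in_cquot_proj[OF Z] by (rule someI)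
      then have "(SOME w. w \<in> cquot_proj Z z) - z \<in> periods Z" by (auto simp: cquot_proj_eq)
      then show ?thesis using per by (simp add: f_def)
    qed
    \<comment> \<open>On the ambient space \<open>g\<close> may be unbounded; \<open>h\<close> is a
      bounded functional that agrees with it on \<open>Cn ?d\<close>, as the derivative
      requires.\<close>
    define h where "h z = (\<Sum>i<?d. Poly_Mapping.lookup z i * g (Poly_Mapping.single i 1))" for z
    have h: "g z = h z" if "z \<in> Cn ?d" for z
      by (subst Cn_expand[OF that])
         (simp add: h_def cfun.linear_sum[OF g] cfun.linear_scale[OF g])
    have bh: "bounded_linear h"
      unfolding h_def by (intro bounded_linear_sum bounded_linear_mult_const bounded_linear_lookup)
    have "holomorphic_fun Z f"
      unfolding holomorphic_fun_def holomorphic_Cn_def f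
    proof
      fix z assume z: "z \<in> Cn ?d"
      have "(exp has_derivative (*) (exp (c * h z))) (at (c * h z))"
        using DERIV_exp by (rule has_field_derivative_imp_has_derivative)
      then have "((\<lambda>z. exp (c * h z)) has_derivative (\<lambda>v. exp (c * h z) * (c * h v))) (at z within Cn ?d)"
        by (rule has_derivative_compose[rotated])
           (rule bounded_linear_imp_has_derivative[OF bounded_linear_const_mult[OF bh]])
      then have "((\<lambda>z. exp (c * g z)) has_derivative (\<lambda>v. exp (c * h z) * (c * h v))) (at z within Cn ?d)"
        by (rule has_derivative_transform[rotated 2]) (use z h in auto)
      moreover have "h (cscale a v) = a * h v" for a v
        by (simp add: h_def lookup_cscale sum_distrib_left mult.assoc)
      ultimately show "\<exists>f'. ((\<lambda>z. exp (c * g z)) has_derivative f') (at z within Cn ?d) \<and>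
          (\<forall>a. \<forall>v\<in>Cn ?d. f' (cscale a v) = a * f' v)"
        by (intro exI[of _ "\<lambda>v. exp (c * h z) * (c * h v)"]) auto
    qed
    then obtain a where a: "\<And>x. x \<in> carrier (cquot_group Z) \<Longrightarrow> f x = a"
      using const by metis
    have "exp (c * g z) = a" if "z \<in> Cn ?d" for z
      using a[of "cquot_proj Z z"] f that by (simp add: carrier_cquot_group)
    \<comment> \<open>At \<open>v\<close> divided by 2 \<open>M\<close> the exponent is pi times the
      imaginary unit, so the value is -1, against 1 at the origin.\<close>
    from this[of 0] this[of "(1 / (2 * real M)) *\<^sub>R v"]
    have "exp (c * g ((1 / (2 * real M)) *\<^sub>R v)) = 1"
      using Cn_scaleR[OF v(1)] by (simp add: cfun.linear_0[OF g])
    moreover have "c * g ((1 / (2 * real M)) *\<^sub>R v) = of_real pi * \<i>"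
      using M(1) v(2) by (simp add: gR c_def)
    ultimately show False by simp
  qed
  then show ?thesis
    using up by (intro exI[of _ "dim (periods Z) - ?d"]) auto
qed

text \<open>Simplicity leaves two possibilities for the subgroup \<open>K\<close> given by the image
  of \<open>e\<close>, and each puts a vector space into a discrete group. If \<open>K\<close> is
  everything, all vectors \<open>v\<close> - \<open>e v\<close> lie in \<open>D\<close>; if
  \<open>K\<close> is trivial, the whole image of \<open>q\<close> consists of periods. Closure
  under real multiples then forces these vectors to be 0.\<close>

lemma simple_idempotent:
  assumes X: "geometrically_simple X" and e: "qhom X X e"
    and idem: "\<forall>v\<in>Cn (cdim X). e (e v) = e v"
  shows "(\<forall>v\<in>Cn (cdim X). e v = 0) \<or> (\<forall>v\<in>Cn (cdim X). e v = v)"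
proof -
  let ?n = "cdim X"
  have tor: "toroidal X" using X by (simp add: geometrically_simple_def)
  have Xc: "is_cquot X" and le: "clinear e" using e by (auto simp: qhom_def)
  have eC: "e v \<in> Cn ?n" if "v \<in> Cn ?n" for v using e that by (rule qhom.hom_closed)
  note G = add_subgroup_periods[OF Xc] and sub = periods_subset[OF Xc] and disc = discrete_periods[OF Xc]
  obtain N where N: "N > 0" "\<And>\<gamma>. \<gamma> \<in> periods X \<Longrightarrow> real N *\<^sub>R e \<gamma> \<in> periods X"
    using e unfolding qhom_def by metis
  from split_idempotent[OF e idem] obtain Z p q where p: "qhom X Z p" and q: "qhom Z X q"
    and pq: "\<forall>w\<in>Cn (cdim Z). p (q w) = w" and qp: "\<forall>v\<in>Cn ?n. q (p v) = e v"
    and PZ: "periods Z = {w \<in> Cn (cdim Z). q w \<in> periods X}"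
    by (elim exE conjE) (rule that)
  note pq = bspec[OF pq] and qp = bspec[OF qp]
  let ?d = "cdim Z"
  have Zc: "is_cquot Z" and lq: "clinear q" using q by (auto simp: qhom_def)
  have pC: "p v \<in> Cn ?d" if "v \<in> Cn ?n" for v using p that by (rule qhom.hom_closed)
  have qC: "q w \<in> Cn ?n" if "w \<in> Cn ?d" for w using q that by (rule qhom.hom_closed)
  show ?thesis
  proof (cases "?d \<ge> 1")
    \<comment> \<open>The zero group is not toroidal, so a zero-dimensional image is treated apart;
      there \<open>e\<close> vanishes.\<close>
    case False
    then have "p v = 0" if "v \<in> Cn ?n" for v
      using pC[OF that] by (intro poly_mapping_eqI) (simp add: Cn_iff)
    then show ?thesis using qp cvec_pair.linear_0[OF lq] by metis
  next
    case True
    have surj: "p ` Cn ?n = Cn ?d"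
    proof (intro equalityI subsetI)
      fix w assume "w \<in> Cn ?d"
      then show "w \<in> p ` Cn ?n" using pq qC by (metis imageI)
    qed (use pC in auto)
    have torZ: "toroidal Z"
      unfolding toroidal_def
      using Zc toroidal_quotient[OF tor p surj] rank_of_constant_functions[OF Zc True] by blast
    have ind: "induced_map X q (cquot_proj Z w) = cquot_proj X (q w)" for w
      by (rule induced_map_proj[OF Zc Xc lq]) (auto simp: PZ)
    have hom: "holomorphic_hom Z X (induced_map X q)"
      by (rule holomorphic_hom_induced_map[OF Zc Xc lq]) (use qC in \<open>auto simp: PZ\<close>)
    define K where "K = induced_map X q ` carrier (cquot_group Z)"
    have K: "K = (\<lambda>w. cquot_proj X (q w)) ` Cn ?d"
      by (simp add: K_def carrier_cquot_group image_image ind)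
    \<comment> \<open>Elements of \<open>D\<close> need not be periods because \<open>e\<close> is
      only rational, but \<open>N\<close> times each of them is one, which suffices for
      discreteness.\<close>
    define D where "D = (\<lambda>\<gamma>. \<gamma> - e \<gamma>) ` periods X"
    have lc: "clinear (\<lambda>v. v - e v)"
      by (rule cvec_pair.linear_compose_sub[OF cvec.linear_ident le])
    have D: "add_subgroup D"
      unfolding add_subgroup_def
    proof (intro conjI ballI)
      show "0 \<in> D" unfolding D_def
        using add_subgroup_0[OF G] cvec_pair.linear_0[OF lc] by (metis imageI)
      fix x y assume "x \<in> D" "y \<in> D"
      then obtain a b where ab: "a \<in> periods X" "b \<in> periods X" "x = a - e a" "y = b - e b"
        by (auto simp: D_def)
      then have "x - y = (a - b) - e (a - b)" using cvec_pair.linear_diff[OF lc, of a b] by simp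
      then show "x - y \<in> D" unfolding D_def using add_subgroup_diff[OF G ab(1,2)] by (metis imageI)
    qed
    have ND: "real N *\<^sub>R x \<in> periods X" if xD: "x \<in> D" for x
    proof -
      obtain a where a: "a \<in> periods X" "x = a - e a" using xD by (auto simp: D_def)
      then show ?thesis
        using add_subgroup_diff[OF G add_subgroup_nat[OF G a(1)] N(2)[OF a(1)]]
        by (simp add: scaleR_diff_right)
    qed
    have discD: "discrete D"
      by (rule discrete_of_multiple[OF D G disc N(1) ND])
    \<comment> \<open>\<open>\<Gamma> + im e\<close> is closed, being the preimage of the discrete group \<open>(1 - e) \<Gamma>\<close> under \<open>1 - e\<close>\<close>
    have Kmem: "v \<in> \<Union>K \<longleftrightarrow> v \<in> Cn ?n \<and> v - e v \<in> D" for v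
    proof
      assume "v \<in> \<Union>K"
      then obtain w \<gamma> where w: "w \<in> Cn ?d" "\<gamma> \<in> periods X" "v = \<gamma> + q w"
        by (auto simp: K cquot_proj_eq)
      have "e (q w) = q w" using qp[OF qC[OF w(1)]] pq[OF w(1)] by simp
      then have "v - e v = \<gamma> - e \<gamma>" using w(3) cvec_pair.linear_add[OF le] by simp
      then have "v - e v \<in> D" unfolding D_def using w(2) by (rule image_eqI)
      moreover have "v \<in> Cn ?n" unfolding w(3) using w(2) sub qC[OF w(1)] by (intro Cn_add) auto
      ultimately show "v \<in> Cn ?n \<and> v - e v \<in> D" by blast
    next
      assume v: "v \<in> Cn ?n \<and> v - e v \<in> D"
      then obtain \<gamma> where \<gamma>: "\<gamma> \<in> periods X" "v - e v = \<gamma> - e \<gamma>" by (auto simp: D_def)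
      have vg: "v - \<gamma> \<in> Cn ?n" using v \<gamma>(1) sub by (intro Cn_diff) auto
      have "e (v - \<gamma>) = e v - e \<gamma>" by (rule cvec_pair.linear_diff[OF le])
      moreover have "v - \<gamma> = e v - e \<gamma>" using \<gamma>(2) by (simp add: algebra_simps)
      ultimately have "v - \<gamma> = e (v - \<gamma>)" by (simp only:)
      then have "v = \<gamma> + q (p (v - \<gamma>))" using qp[OF vg] by (metis add_diff_cancel_left' diff_add_cancel add.commute)
      then have "v \<in> cquot_proj X (q (p (v - \<gamma>)))"
        unfolding cquot_proj_eq using \<gamma>(1) by (rule image_eqI)
      then show "v \<in> \<Union>K" using pC[OF vg] by (auto simp: K)
    qed
    have "closedin (top_of_set (Cn ?n)) (\<Union>K)"
    proof -
      have "closed D"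
        using uniform_discrete_subgroup[OF D discD] by (rule uniform_discrete_imp_closed)
      then have "closedin (top_of_set (Cn ?n)) (Cn ?n \<inter> (\<lambda>v. v - e v) -` D)"
        by (rule continuous_closedin_preimage[OF continuous_on_clinear[OF lc]])
      moreover have "Cn ?n \<inter> (\<lambda>v. v - e v) -` D = \<Union>K" using Kmem by blast
      ultimately show ?thesis by simp
    qed
    moreover have "subgroup K (cquot_group X)"
    proof -
      interpret group_hom "cquot_group Z" "cquot_group X" "induced_map X q"
        using hom group_cquot_group[OF Zc] group_cquot_group[OF Xc]
        by (simp add: group_hom_def group_hom_axioms_def holomorphic_hom_def)
      show ?thesis unfolding K_def by (rule img_is_subgroup)
    qed
    moreover have "inj_on (induced_map X q) (carrier (cquot_group Z))"
    proof (rule inj_onI)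
      fix x y assume "x \<in> carrier (cquot_group Z)" "y \<in> carrier (cquot_group Z)"
        and eq: "induced_map X q x = induced_map X q y"
      then obtain u w where uw: "u \<in> Cn ?d" "w \<in> Cn ?d" "x = cquot_proj Z u" "y = cquot_proj Z w"
        by (auto simp: carrier_cquot_group)
      then have "q u - q w \<in> periods X" using eq ind cquot_proj_eq_iff[OF Xc] by simp
      then have "u - w \<in> periods Z"
        using uw(1,2) cvec_pair.linear_diff[OF lq] by (simp add: PZ Cn_diff)
      then show "x = y" using uw(3,4) cquot_proj_eq_iff[OF Zc] by simp
    qed
    ultimately have "closed_toroidal_subgroup X K"
      using torZ hom K_def unfolding closed_toroidal_subgroup_def by blast
    then consider "K = carrier (cquot_group X)" | "K = {\<one>\<^bsub>cquot_group X\<^esub>}"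
      using X unfolding geometrically_simple_def by blast
    then show ?thesis
    proof cases
      case 1
      have "v - e v \<in> D" if "v \<in> Cn ?n" for v
      proof -
        have "cquot_proj X v \<in> K" using 1 that by (simp add: carrier_cquot_group)
        then have "v \<in> \<Union>K" using in_cquot_proj[OF Xc] by blast
        then show ?thesis using Kmem by blast
      qed
      then have "t *\<^sub>R (v - e v) \<in> D" if "v \<in> Cn ?n" for v t
        using Cn_scaleR[OF that] clinear_scaleR[OF lc] by metis
      then have "v - e v = 0" if "v \<in> Cn ?n" for v
        using real_multiples_in_discrete_subgroup[OF D discD] that by blast
      then show ?thesis by simp
    next
      case 2
      have mem: "q w \<in> periods X" if "w \<in> Cn ?d" for w
      proof -
        have "cquot_proj X (q w) = cquot_proj X 0"
          using 2 that by (auto simp: K one_cquot_group)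
        then show ?thesis using cquot_proj_eq_iff[OF Xc, of "q w" 0] by simp
      qed
      have "t *\<^sub>R q w \<in> periods X" if "w \<in> Cn ?d" for t w
        using mem[OF Cn_scaleR[OF that]] clinear_scaleR[OF lq] by metis
      then have "q w = 0" if "w \<in> Cn ?d" for w
        using real_multiples_in_discrete_subgroup[OF G disc] that by blast
      then show ?thesis using qp pC by metis
    qed
  qed
qed

section \<open>Fitting's lemma and local endomorphism rings\<close>

text \<open>A linear inverse \<open>T\<close> exists by dimension; the point is its rationality. The
  integral multiple \<open>f\<close> of \<open>a\<close> maps the real span of the periods
  injectively, hence onto, itself. So the images of the periods span the same space and
  \<open>M\<close> times any period is some \<open>f\<close> \<delta>, on which \<open>T\<close>
  gives \<open>N\<close> times \<delta>.\<close>

lemma injective_endomorphism_invertible: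
  assumes a: "qhom X X a" and inj: "inj_on a (Cn (cdim X))"
  shows "qhom.invertible X X a"
proof -
  let ?n = "cdim X"
  have X: "is_cquot X" and la: "clinear a" and aC: "a ` Cn ?n \<subseteq> Cn ?n"
    using a by (auto simp: qhom_def)
  note G = add_subgroup_periods[OF X] and sub = periods_subset[OF X] and disc = discrete_periods[OF X]
  obtain N where N: "N > 0" "\<And>\<gamma>. \<gamma> \<in> periods X \<Longrightarrow> real N *\<^sub>R a \<gamma> \<in> periods X"
    using a unfolding qhom_def by metis
  obtain E where E: "finite E" "Cn ?n \<subseteq> span E"
    using Cn_real_span by metis
  have "a ` Cn ?n = Cn ?n"
    by (rule linear_inj_on_imp_surj_on[OF E subspace_Cn clinear_imp_linear[OF la] inj aC])
  then obtain T where T: "clinear T" "\<And>v. T v \<in> Cn ?n" "\<And>v. v \<in> Cn ?n \<Longrightarrow> T (a v) = v"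
    "\<And>w. w \<in> Cn ?n \<Longrightarrow> a (T w) = w"
    using clinear_inverse[OF la inj] by metis
  define f where "f v = real N *\<^sub>R a v" for v
  have lf: "clinear f" unfolding f_def by (rule clinear_scaleR_left[OF la])
  have fG: "f ` periods X \<subseteq> periods X" using N(2) by (auto simp: f_def)
  let ?S = "span (periods X)"
  have SC: "?S \<subseteq> Cn ?n" using sub subspace_Cn by (rule span_minimal)
  have img: "span (f ` periods X) = f ` ?S"
    by (rule linear_span_image[OF clinear_imp_linear[OF lf]])
  have "f ` ?S = ?S"
  proof (rule linear_inj_on_imp_surj_on[OF E(1) _ subspace_span clinear_imp_linear[OF lf]])
    show "?S \<subseteq> span E" using SC E(2) by simp
    show "f ` ?S \<subseteq> ?S" using fG span_mono img by blast
    show "inj_on f ?S"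
      using inj SC N(1) unfolding f_def inj_on_def by (auto simp: subset_iff)
  qed
  then have sp: "periods X \<subseteq> span (f ` periods X)" using img span_superset by blast
  have "add_subgroup (f ` periods X)"
    unfolding add_subgroup_def
  proof (intro conjI ballI)
    show "0 \<in> f ` periods X"
      using add_subgroup_0[OF G] cvec_pair.linear_0[OF lf] by (metis imageI)
    fix x y assume "x \<in> f ` periods X" "y \<in> f ` periods X"
    then obtain u w where "u \<in> periods X" "w \<in> periods X" "x = f u" "y = f w" by blast
    then show "x - y \<in> f ` periods X"
      using add_subgroup_diff[OF G] cvec_pair.linear_diff[OF lf] by (metis imageI)
  qed
  from torsion_of_span[OF this G disc sub fG sp]
  obtain M where M: "M > 0" "\<forall>\<gamma>\<in>periods X. real M *\<^sub>R \<gamma> \<in> f ` periods X" by blast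
  have "real M *\<^sub>R T \<gamma> \<in> periods X" if \<gamma>: "\<gamma> \<in> periods X" for \<gamma>
  proof -
    obtain \<delta> where \<delta>: "\<delta> \<in> periods X" "real M *\<^sub>R \<gamma> = f \<delta>" using M(2) \<gamma> by blast
    have "real M *\<^sub>R T \<gamma> = T (real M *\<^sub>R \<gamma>)" by (simp add: clinear_scaleR[OF T(1)])
    also have "\<dots> = real N *\<^sub>R T (a \<delta>)" unfolding \<delta>(2) f_def by (rule clinear_scaleR[OF T(1)])
    also have "\<dots> = real N *\<^sub>R \<delta>" using T(3) \<delta>(1) sub by auto
    finally show ?thesis using add_subgroup_nat[OF G \<delta>(1)] by simp
  qed
  then have "qhom X X T" using X T(1,2) M(1) by (auto simp: qhom_def)
  then show ?thesis
    unfolding qhom.invertible_def qhom.inverse_pair_def using a T(3,4) by blast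
qed

text \<open>
  The projection \<open>e\<close> onto the image of \<open>b\<close> along its kernel is rational: for an integral multiple
  \<open>f\<close> of \<open>b\<close>, the groups \<open>f (f \<Gamma>) \<subseteq> f \<Gamma>\<close> have the same real span, so \<open>M f \<gamma> = f (f \<delta>)\<close> with \<open>M\<close>
  independent of \<open>\<gamma>\<close>, and then \<open>e (M \<gamma>) = f \<delta>\<close>.
\<close>

lemma fitting_idempotent:
  assumes b: "qhom X X b" and stable: "b ` b ` Cn (cdim X) = b ` Cn (cdim X)"
  shows "\<exists>e. qhom X X e \<and> (\<forall>v\<in>Cn (cdim X). e v \<in> b ` Cn (cdim X) \<and> e (e v) = e v \<and> b (e v) = b v)"
proof -
  let ?n = "cdim X"
  define I where "I = b ` Cn ?n"
  have X: "is_cquot X" and lb: "clinear b" and bC: "I \<subseteq> Cn ?n"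
    using b by (auto simp: qhom_def I_def)
  note G = add_subgroup_periods[OF X] and sub = periods_subset[OF X] and disc = discrete_periods[OF X]
  obtain N where N: "N > 0" "\<And>\<gamma>. \<gamma> \<in> periods X \<Longrightarrow> real N *\<^sub>R b \<gamma> \<in> periods X"
    using b unfolding qhom_def by metis
  obtain E where E: "finite E" "Cn ?n \<subseteq> span E"
    using Cn_real_span by metis
  have bI: "b ` I = I" using stable by (simp add: I_def)
  have csub: "cvec.subspace I"
    unfolding I_def by (rule cvec_pair.linear_subspace_image[OF lb csubspace_Cn])
  have rsub: "subspace I"
    unfolding I_def by (rule linear_subspace_image[OF clinear_imp_linear[OF lb] subspace_Cn])
  have "I \<subseteq> span E" using bC E(2) by simp
  then have inj: "inj_on b I"
    by (rule linear_surj_on_imp_inj_on[OF E(1) _ rsub clinear_imp_linear[OF lb] bI])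
  \<comment> \<open>On its stable image \<open>I\<close> the map \<open>b\<close> is bijective, and
    \<open>e\<close> is \<open>b\<close> followed by the inverse of this restriction. The columns of
    \<open>e\<close> are the images of the units.\<close>
  define c where "c i = inv_into I b (b (Poly_Mapping.single i 1))" for i :: nat
  have c: "c i \<in> I" "b (c i) = b (Poly_Mapping.single i 1)" if "i < ?n" for i
  proof -
    have "b (Poly_Mapping.single i 1) \<in> b ` I"
      unfolding bI unfolding I_def using single_in_Cn[OF that] by (rule imageI)
    then show "c i \<in> I" "b (c i) = b (Poly_Mapping.single i 1)"
      unfolding c_def by (rule inv_into_into, rule f_inv_into_f)
  qed
  define e where "e = lin_of ?n c"
  have le: "clinear e" unfolding e_def by (rule clinear_lin_of)
  have eI: "e v \<in> I" for v
    unfolding e_def lin_of_def using c(1)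
    by (intro cvec.subspace_sum[OF csub] cvec.subspace_scale[OF csub]) auto
  have be: "b (e v) = b v" if "v \<in> Cn ?n" for v
    using c(2) clinear_eq_lin_of[OF lb that]
    by (simp add: e_def lin_of_def cvec_pair.linear_sum[OF lb] cvec_pair.linear_scale[OF lb])
  have eid: "e v = v" if "v \<in> I" for v
    using inj_onD[OF inj be eI that] bC that by blast
  define f where "f v = real N *\<^sub>R b v" for v
  have lf: "clinear f" unfolding f_def by (rule clinear_scaleR_left[OF lb])
  have fG: "f ` periods X \<subseteq> periods X" using N(2) by (auto simp: f_def)
  have fI: "f v \<in> I" if "v \<in> Cn ?n" for v
    unfolding f_def using that by (intro subspace_scale[OF rsub]) (simp add: I_def)
  let ?F = "f ` periods X"
  have image_subgroup: "add_subgroup (f ` H)" if H: "add_subgroup H" for H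
    unfolding add_subgroup_def
  proof (intro conjI ballI)
    show "0 \<in> f ` H"
      using add_subgroup_0[OF H] cvec_pair.linear_0[OF lf] by (metis imageI)
    fix x y assume "x \<in> f ` H" "y \<in> f ` H"
    then obtain u w where "u \<in> H" "w \<in> H" "x = f u" "y = f w" by blast
    then show "x - y \<in> f ` H"
      using add_subgroup_diff[OF H] cvec_pair.linear_diff[OF lf] by (metis imageI)
  qed
  have F: "add_subgroup ?F" "add_subgroup (f ` ?F)"
    using image_subgroup G by auto
  have FF: "f ` ?F \<subseteq> ?F" using fG by (rule image_mono)
  have FI: "?F \<subseteq> I" using fI sub by auto
  have spI: "span ?F \<subseteq> I" using FI rsub by (rule span_minimal)
  have img: "span (f ` ?F) = f ` span ?F"
    by (rule linear_span_image[OF clinear_imp_linear[OF lf]])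
  have "f ` span ?F = span ?F"
  proof (rule linear_inj_on_imp_surj_on[OF E(1) _ subspace_span clinear_imp_linear[OF lf]])
    show "span ?F \<subseteq> span E" using spI bC E(2) by simp
    show "f ` span ?F \<subseteq> span ?F" using span_mono[OF FF] img by simp
    show "inj_on f (span ?F)"
      using inj spI N(1) unfolding f_def inj_on_def by (auto simp: subset_iff)
  qed
  then have sp: "?F \<subseteq> span (f ` ?F)" by (simp only: img span_superset)
  have FC: "?F \<subseteq> Cn ?n" using fG sub by simp
  have "discrete ?F" using disc fG by (rule discrete_subset)
  from torsion_of_span[OF F(2,1) this FC FF sp]
  obtain M where M: "M > 0" "\<forall>x\<in>?F. real M *\<^sub>R x \<in> f ` ?F"
    by (elim exE conjE) (rule that)
  have "real M *\<^sub>R e \<gamma> \<in> periods X" if \<gamma>: "\<gamma> \<in> periods X" for \<gamma>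
  proof -
    have "real M *\<^sub>R f \<gamma> \<in> f ` ?F" using bspec[OF M(2) imageI[OF \<gamma>]] .
    then obtain \<delta> where \<delta>: "\<delta> \<in> periods X" "real M *\<^sub>R f \<gamma> = f (f \<delta>)" by blast
    have \<gamma>C: "real M *\<^sub>R \<gamma> \<in> Cn ?n" using \<gamma> sub by (intro Cn_scaleR) auto
    have "f (real M *\<^sub>R \<gamma>) = f (f \<delta>)" using \<delta>(2) clinear_scaleR[OF lf] by simp
    then have "b (real M *\<^sub>R \<gamma>) = b (f \<delta>)" using N(1) by (simp add: f_def)
    then have "b (e (real M *\<^sub>R \<gamma>)) = b (f \<delta>)" using be[OF \<gamma>C] by simp
    moreover have "f \<delta> \<in> I" using fI \<delta>(1) sub by auto
    ultimately have "e (real M *\<^sub>R \<gamma>) = f \<delta>"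
      using inj_onD[OF inj _ eI] by blast
    then have "real M *\<^sub>R e \<gamma> = f \<delta>" using clinear_scaleR[OF le] by simp
    then show ?thesis using fG \<delta>(1) by auto
  qed
  then have "qhom X X e" using X le eI bC M(1) by (auto simp: qhom_def)
  moreover have "e (e v) = e v" for v using eid eI by blast
  ultimately show ?thesis using eI be unfolding I_def by blast
qed

text \<open>The idempotent \<open>e\<close> attached to a stable power \<open>b\<close> of
  \<open>a\<close> satisfies \<open>b e\<close> = \<open>b\<close>. If \<open>e\<close> is 0, then
  so is \<open>b\<close>, and a vector fixed by \<open>a\<close> is fixed by \<open>b\<close> and
  vanishes; hence 1 - \<open>a\<close> is injective. If \<open>e\<close> is 1, then \<open>b\<close>
  is onto, so \<open>b\<close> and with it \<open>a\<close> are injective. In both cases injectivity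
  is enough for a unit.\<close>

lemma geometrically_simple_local:
  assumes X: "geometrically_simple X"
  shows "qhom.local_object X"
  unfolding qhom.local_object_def
proof (intro conjI allI impI)
  let ?n = "cdim X"
  have tor: "toroidal X" using X by (simp add: geometrically_simple_def)
  then have Xc: "is_cquot X" and n: "?n \<ge> 1" by (auto simp: toroidal_def)
  show "qhom X X (\<lambda>v. v)" by (rule qhom_id[OF Xc])
  have "Poly_Mapping.single 0 1 \<in> Cn ?n" using n by (intro single_in_Cn) simp
  moreover have "Poly_Mapping.single 0 1 \<noteq> (0 :: cvec)"
    by (metis lookup_single_eq lookup_zero zero_neq_one)
  ultimately show "Cn ?n \<noteq> {0}" by blast
  fix a assume a: "qhom X X a"
  have la: "clinear a" using a by (simp add: qhom_def)
  have pow: "qhom X X (a ^^ r)" for r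
  proof (induction r)
    case (Suc r)
    then show ?case using qhom.hom_comp[OF Suc a] by (simp add: comp_def)
  qed (simp add: id_def qhom_id[OF Xc])
  obtain E where E: "finite E" "Cn ?n \<subseteq> span E"
    using Cn_real_span by metis
  \<comment> \<open>A power whose image has least dimension; its square then has the same image.
    Exponents start at 1 so that injectivity of the power implies injectivity of
    \<open>a\<close>.\<close>
  have "\<exists>r. True \<and> (\<forall>s. True \<longrightarrow> dim ((a ^^ Suc r) ` Cn ?n) \<le> dim ((a ^^ Suc s) ` Cn ?n))"
    by (rule ex_has_least_nat[of "\<lambda>_. True"]) simp
  then obtain r where r: "\<And>s. dim ((a ^^ Suc r) ` Cn ?n) \<le> dim ((a ^^ Suc s) ` Cn ?n)" by blast
  define b where "b = a ^^ Suc r"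
  have b: "qhom X X b" unfolding b_def by (rule pow)
  then have lb: "clinear b" and bC: "b ` Cn ?n \<subseteq> Cn ?n" by (auto simp: qhom_def)
  have bb: "b ` b ` Cn ?n = (a ^^ Suc (r + Suc r)) ` Cn ?n"
    using funpow_add[of "Suc r" "Suc r" a] by (simp only: b_def image_comp add_Suc)
  have "b ` b ` Cn ?n = b ` Cn ?n"
  proof (rule subspace_eq_of_dim[OF E(1)])
    show "b ` Cn ?n \<subseteq> span E" using bC E(2) by simp
    show "subspace (b ` b ` Cn ?n)"
      by (intro linear_subspace_image[OF clinear_imp_linear[OF lb]] subspace_Cn)
    show "b ` b ` Cn ?n \<subseteq> b ` Cn ?n" using bC by (rule image_mono)
    show "dim (b ` Cn ?n) \<le> dim (b ` b ` Cn ?n)" unfolding bb unfolding b_def by (rule r)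
  qed
  from fitting_idempotent[OF b this] obtain e where e: "qhom X X e"
    and eb: "\<forall>v\<in>Cn ?n. e v \<in> b ` Cn ?n \<and> e (e v) = e v \<and> b (e v) = b v" by blast
  have "\<forall>v\<in>Cn ?n. e (e v) = e v" using eb by blast
  from simple_idempotent[OF X e this]
  show "qhom.invertible X X a \<or> qhom.invertible X X (\<lambda>v. v - a v)"
  proof
    assume "\<forall>v\<in>Cn ?n. e v = 0"
    then have nil: "b v = 0" if "v \<in> Cn ?n" for v
      using eb that cvec_pair.linear_0[OF lb] by metis
    have d: "qhom X X (\<lambda>v. v - a v)" by (rule qhom.hom_diff[OF qhom_id[OF Xc] a])
    then have ld: "clinear (\<lambda>v. v - a v)" by (simp add: qhom_def)
    have "inj_on (\<lambda>v. v - a v) (Cn ?n)"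
    proof (subst linear_inj_on_iff_eq_0[OF clinear_imp_linear[OF ld] subspace_Cn], intro ballI impI)
      fix v assume v: "v \<in> Cn ?n" "v - a v = 0"
      then have "(a ^^ s) v = v" for s by (induction s) auto
      then show "v = 0" using nil[OF v(1)] by (simp add: b_def del: funpow.simps)
    qed
    then show ?thesis using injective_endomorphism_invertible[OF d] by blast
  next
    assume "\<forall>v\<in>Cn ?n. e v = v"
    then have "Cn ?n \<subseteq> b ` Cn ?n" using eb by (metis subsetI)
    then have surj: "b ` Cn ?n = Cn ?n" using bC by blast
    have inj: "inj_on b (Cn ?n)"
      by (rule linear_surj_on_imp_inj_on[OF E subspace_Cn clinear_imp_linear[OF lb] surj])
    have "inj_on a (Cn ?n)"
    proof (rule inj_onI)
      fix v w assume vw: "v \<in> Cn ?n" "w \<in> Cn ?n" "a v = a w"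
      then have "b v = b w" by (simp add: b_def funpow_Suc_right del: funpow.simps)
      then show "v = w" using inj vw(1,2) by (simp add: inj_on_def)
    qed
    then show ?thesis using injective_endomorphism_invertible[OF a] by blast
  qed
qed

section \<open>Uniqueness of the simple factors\<close>

text \<open>The relation \<open>isogenous\<close> allows an isogeny in either direction; the
  direction is irrelevant after inversion in the isogeny category.\<close>

lemma isogenous_imp_inverse_pair:
  assumes X: "is_cquot X" and Y: "is_cquot Y" and iso: "isogenous X Y"
  shows "\<exists>L T. qhom.inverse_pair X Y L T"
proof -
  have "(\<exists>L. qhom.invertible X Y L) \<or> (\<exists>L. qhom.invertible Y X L)"
    using iso isogeny_imp_invertible[OF X Y] isogeny_imp_invertible[OF Y X]
    unfolding isogenous_def by blast
  then show ?thesis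
    unfolding qhom.invertible_def qhom.inverse_pair_def by blast
qed

theorem theorem3:
  fixes X :: cquot and k l :: nat and Xs Ys :: "nat \<Rightarrow> cquot"
  assumes "quasi_abelian X" and "qa_kind X = 0"
    and "\<And>i. i < k \<Longrightarrow> quasi_abelian (Xs i) \<and> qa_kind (Xs i) = 0 \<and> geometrically_simple (Xs i)"
    and "isogenous X (cquot_prod k Xs)"
    and "\<And>j. j < l \<Longrightarrow> quasi_abelian (Ys j) \<and> geometrically_simple (Ys j)"
    and "isogenous X (cquot_prod l Ys)"
  shows "k = l \<and> (\<exists>\<sigma>. bij_betw \<sigma> {..<k} {..<l} \<and> (\<forall>i<k. isogenous (Xs i) (Ys (\<sigma> i))))"
proof -
  let ?P = "cquot_prod k Xs" and ?Q = "cquot_prod l Ys"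
  have X: "is_cquot X" using assms(1) by (simp add: quasi_abelian_def toroidal_def)
  have Xs: "is_cquot (Xs i)" if "i < k" for i
    using assms(3)[OF that] by (simp add: quasi_abelian_def toroidal_def)
  have Ys: "is_cquot (Ys j)" if "j < l" for j
    using assms(5)[OF that] by (simp add: quasi_abelian_def toroidal_def)
  obtain A A' where A: "qhom.inverse_pair X ?P A A'"
    using isogenous_imp_inverse_pair[OF X is_cquot_prod[OF Xs] assms(4)] by blast
  obtain B B' where B: "qhom.inverse_pair X ?Q B B'"
    using isogenous_imp_inverse_pair[OF X is_cquot_prod[OF Ys] assms(6)] by blast
  \<comment> \<open>Passing through \<open>X\<close> identifies the two products by mutually inverse
    rational maps.\<close>
  define F where "F v = B (A' v)" for v
  define G where "G v = A (B' v)" for v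
  have F: "qhom ?P ?Q F" and G: "qhom ?Q ?P G"
    using A B unfolding F_def G_def qhom.inverse_pair_def by (auto intro: qhom.hom_comp)
  have GF: "G (F v) = v" if "v \<in> Cn (cdim ?P)" for v
    using A B that qhom.hom_closed unfolding F_def G_def qhom.inverse_pair_def by metis
  have FG: "F (G v) = v" if "v \<in> Cn (cdim ?Q)" for v
    using A B that qhom.hom_closed unfolding F_def G_def qhom.inverse_pair_def by metis
  \<comment> \<open>Matrix entries of \<open>F\<close> and \<open>G\<close> for the two
    decompositions. The matrices are mutually inverse because injections and projections of each
    product sum to its identity.\<close>
  define f where "f i j v = prod_proj Ys j (F (prod_inj Xs i v))" for i j v
  define g where "g j i v = prod_proj Xs i (G (prod_inj Ys j v))" for j i v
  have "\<exists>\<sigma>. bij_betw \<sigma> {..<k} {..<l} \<and> (\<forall>i\<in>{..<k}. \<exists>h. qhom.invertible (Xs i) (Ys (\<sigma> i)) h)"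
  proof (rule qhom.Krull_Schmidt[where f = f and g = g])
    fix i j assume ij: "i \<in> {..<k}" "j \<in> {..<l}"
    show "qhom (Xs i) (Ys j) (f i j)"
      unfolding f_def using ij Xs Ys F
      by (intro qhom.hom_comp[OF qhom.hom_comp[OF qhom_prod_inj F] qhom_prod_proj]) auto
    show "qhom (Ys j) (Xs i) (g j i)"
      unfolding g_def using ij Xs Ys G
      by (intro qhom.hom_comp[OF qhom.hom_comp[OF qhom_prod_inj G] qhom_prod_proj]) auto
  next
    fix i i' v assume i: "i \<in> {..<k}" "i' \<in> {..<k}" and v: "v \<in> Cn (cdim (Xs i))"
    have Gp: "qhom ?Q (Xs i') (\<lambda>v. prod_proj Xs i' (G v))"
      using qhom.hom_comp[OF G qhom_prod_proj] Xs i by blast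
    have iv: "prod_inj Xs i v \<in> Cn (cdim ?P)"
      using prod_inj_in_Cn i(1) by (simp add: cdim_prod)
    have "(\<Sum>j<l. g j i' (f i j v)) =
        prod_proj Xs i' (G (\<Sum>j<l. prod_inj Ys j (prod_proj Ys j (F (prod_inj Xs i v)))))"
      unfolding f_def g_def by (rule qhom.hom_sum[OF Gp, symmetric])
    also have "(\<Sum>j<l. prod_inj Ys j (prod_proj Ys j (F (prod_inj Xs i v)))) = F (prod_inj Xs i v)"
      using qhom.hom_closed[OF F iv] by (intro sum_prod_inj_proj) (simp add: cdim_prod)
    finally show "(\<Sum>j<l. g j i' (f i j v)) = (if i = i' then v else 0)"
      using GF[OF iv] prod_proj_inj[where X = Xs and i = i, OF v] by simp
  next
    fix j j' v assume j: "j \<in> {..<l}" "j' \<in> {..<l}" and v: "v \<in> Cn (cdim (Ys j))"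
    have Fp: "qhom ?P (Ys j') (\<lambda>v. prod_proj Ys j' (F v))"
      using qhom.hom_comp[OF F qhom_prod_proj] Ys j by blast
    have jv: "prod_inj Ys j v \<in> Cn (cdim ?Q)"
      using prod_inj_in_Cn j(1) by (simp add: cdim_prod)
    have "(\<Sum>i<k. f i j' (g j i v)) =
        prod_proj Ys j' (F (\<Sum>i<k. prod_inj Xs i (prod_proj Xs i (G (prod_inj Ys j v)))))"
      unfolding f_def g_def by (rule qhom.hom_sum[OF Fp, symmetric])
    also have "(\<Sum>i<k. prod_inj Xs i (prod_proj Xs i (G (prod_inj Ys j v)))) = G (prod_inj Ys j v)"
      using qhom.hom_closed[OF G jv] by (intro sum_prod_inj_proj) (simp add: cdim_prod)
    finally show "(\<Sum>i<k. f i j' (g j i v)) = (if j = j' then v else 0)"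
      using FG[OF jv] prod_proj_inj[where X = Ys and i = j, OF v] by simp
  qed (use assms(3,5) geometrically_simple_local in auto)
  then obtain \<sigma> where \<sigma>: "bij_betw \<sigma> {..<k} {..<l}"
    "\<forall>i<k. \<exists>h. qhom.invertible (Xs i) (Ys (\<sigma> i)) h" by auto
  have "k = l" using bij_betw_same_card[OF \<sigma>(1)] by simp
  moreover have "\<forall>i<k. isogenous (Xs i) (Ys (\<sigma> i))"
    using \<sigma>(2) invertible_imp_isogenous by blast
  ultimately show ?thesis using \<sigma>(1) by blast
qed

end
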